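(* Let $k$ be a field, let $n\geq 3$ be an odd integer, and let $\mathcal{A}=\{a_{ij}\in k\mid 1\leq i<j\leq n\}$ be a set of scalars. Let $V_n(\mathcal{A})$ be the $k$-algebra generated by $x_1,\dots,x_n$ subject to the relations $x_ix_j+x_jx_i=a_{ij}$ for all $1\le i<j\le n$. Suppose $\operatorname{char} k$ does not divide $(n-1)!$. Then the group $\operatorname{Aut}(V_n(\mathcal{A}))$ contains a free group on two generators. As a consequence, it contains a free group on countably many generators.
   Context: $\operatorname{Aut}(A)$ denotes the group of $k$-algebra automorphisms of a $k$-algebra $A$. *)

theory Defs
  imports "HOL-Algebra.Algebra" "HOL-Library.Poly_Mapping"
begin

section \<open>Free groups\<close>

text \<open>
  A letter \<open>(s, b)\<close> stands for \<open>s\<close> if \<open>b\<close> holds and for the inverse of \<open>s\<close> otherwise. The free group on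
  \<open>S\<close> consists of the reduced words over these letters, and the product of two reduced words is the
  reduced form of their concatenation.
\<close>

definition cancelling :: "'a \<times> bool \<Rightarrow> 'a \<times> bool \<Rightarrow> bool" where
  "cancelling x y \<longleftrightarrow> fst x = fst y \<and> snd x \<noteq> snd y"

definition reduced :: "('a \<times> bool) list \<Rightarrow> bool" where
  "reduced = successively (\<lambda>x y. \<not> cancelling x y)"

fun cons_reduce :: "'a \<times> bool \<Rightarrow> ('a \<times> bool) list \<Rightarrow> ('a \<times> bool) list" where
  "cons_reduce x [] = [x]"
| "cons_reduce x (y # ys) = (if cancelling x y then ys else x # y # ys)"

definition free_group :: "'a set \<Rightarrow> ('a \<times> bool) list monoid" where
  "free_group S =
    \<lparr>carrier = {w \<in> lists (S \<times> UNIV). reduced w},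
     monoid.mult = foldr cons_reduce,
     one = []\<rparr>"

lemma reduced_Nil [simp]: "reduced []"
  by (simp add: reduced_def)

lemma reduced_Cons: "reduced (x # w) \<longleftrightarrow> reduced w \<and> (w = [] \<or> \<not> cancelling x (hd w))"
  by (cases w) (auto simp: reduced_def)

lemma reduced_cons_reduce: "reduced w \<Longrightarrow> reduced (cons_reduce x w)"
  by (cases w) (auto simp: reduced_Cons)

lemma reduced_foldr: "reduced w \<Longrightarrow> reduced (foldr cons_reduce u w)"
  by (induction u) (auto simp: reduced_cons_reduce)

lemma lists_foldr:
  assumes "u \<in> lists A" "w \<in> lists A"
  shows "foldr cons_reduce u w \<in> lists A"
proof -
  have "cons_reduce x v \<in> lists A" if "x \<in> A" "v \<in> lists A" for x v
    using that by (cases v) auto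
  with assms show ?thesis by (induction u) auto
qed

lemma cons_reduce_inverse:
  assumes "cancelling x y" "reduced w"
  shows "cons_reduce x (cons_reduce y w) = w"
proof (cases w)
  case Nil
  with assms show ?thesis by simp
next
  case (Cons z zs)
  show ?thesis
  proof (cases "cancelling y z")
    case True
    with assms have "x = z" by (auto simp: cancelling_def prod_eq_iff)
    with True assms Cons show ?thesis by (cases zs) (auto simp: reduced_Cons)
  next
    case False
    with assms Cons show ?thesis by simp
  qed
qed

lemma foldr_cons_reduce:
  assumes "reduced w"
  shows "foldr cons_reduce (cons_reduce x v) w = cons_reduce x (foldr cons_reduce v w)"
  using assms by (cases v) (auto simp: cons_reduce_inverse reduced_foldr)

lemma foldr_assoc:
  assumes "reduced w"
  shows "foldr cons_reduce (foldr cons_reduce u v) w = foldr cons_reduce u (foldr cons_reduce v w)"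
  using assms by (induction u) (auto simp: foldr_cons_reduce)

lemma foldr_Nil: "reduced u \<Longrightarrow> foldr cons_reduce u [] = u"
proof (induction u)
  case (Cons x u)
  then show ?case by (cases u) (auto simp: reduced_Cons)
qed simp

lemma foldr_inverse:
  assumes "reduced u"
  shows "foldr cons_reduce (rev (map (apsnd Not) u)) u = []"
  using assms
proof (induction u)
  case (Cons x u)
  have "cancelling (apsnd Not x) x" by (auto simp: cancelling_def)
  with Cons show ?case by (simp add: reduced_Cons)
qed simp

lemma reduced_inverse:
  assumes "reduced u"
  shows "reduced (rev (map (apsnd Not) u))"
  using assms unfolding reduced_def successively_rev successively_map
  by (rule successively_mono) (auto simp: cancelling_def)

lemma group_free_group: "group (free_group S)"
proof (rule groupI)
  fix u assume u: "u \<in> carrier (free_group S)"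
  then have "rev (map (apsnd Not) u) \<in> carrier (free_group S)"
    by (auto simp: free_group_def reduced_inverse in_lists_conv_set)
  moreover have "rev (map (apsnd Not) u) \<otimes>\<^bsub>free_group S\<^esub> u = \<one>\<^bsub>free_group S\<^esub>"
    using u by (simp add: free_group_def foldr_inverse)
  ultimately show "\<exists>v\<in>carrier (free_group S). v \<otimes>\<^bsub>free_group S\<^esub> u = \<one>\<^bsub>free_group S\<^esub>"
    by blast
qed (auto simp: free_group_def reduced_foldr foldr_assoc lists_foldr
       simp del: in_lists_conv_set)


section \<open>Algebras by generators and relations\<close>

text \<open>
  Words form a monoid under concatenation, so that \<open>'x list \<Rightarrow>\<^sub>0 'k\<close>, with its convolution product, is
  the free associative algebra on all of \<open>'x\<close>.
\<close>

instantiation list :: (type) monoid_add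
begin

definition zero_list :: "'a list" where "0 = []"

definition plus_list :: "'a list \<Rightarrow> 'a list \<Rightarrow> 'a list" where "xs + ys = xs @ ys"

instance by standard (auto simp: zero_list_def plus_list_def)

end

text \<open>
  Algebras over \<open>'k\<close> are represented by the record of modules, which already carries a ring
  multiplication; the locale of algebras in the library is not used, because it covers commutative
  algebras only.
\<close>

definition free_algebra :: "'x set \<Rightarrow> ('k::field, 'x list \<Rightarrow>\<^sub>0 'k) module" where
  "free_algebra S =
    \<lparr>carrier = {p. Poly_Mapping.keys p \<subseteq> lists S},
     monoid.mult = (*), one = 1, ring.zero = 0, add = (+),
     smult = (\<lambda>c p. Poly_Mapping.single [] c * p)\<rparr>"

definition quot_algebra ::
    "('k, 'a, 'm) module_scheme \<Rightarrow> 'a set \<Rightarrow> ('k, 'a set) module" where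
  "quot_algebra A I =
    ring.extend (A Quot I) (module.fields (\<lambda>c C. \<Union>x\<in>C. I +>\<^bsub>A\<^esub> (c \<odot>\<^bsub>A\<^esub> x)))"

lemma ring_free_algebra: "ring (free_algebra S :: ('k::field, 'x list \<Rightarrow>\<^sub>0 'k) module)"
proof -
  have times: "Poly_Mapping.keys (p * q) \<subseteq> lists S"
    if "Poly_Mapping.keys p \<subseteq> lists S" "Poly_Mapping.keys q \<subseteq> lists S" for p q :: "'x list \<Rightarrow>\<^sub>0 'k"
    using that keys_mult[of p q] by (fastforce simp: plus_list_def)
  have plus: "Poly_Mapping.keys (p + q) \<subseteq> lists S"
    if "Poly_Mapping.keys p \<subseteq> lists S" "Poly_Mapping.keys q \<subseteq> lists S" for p q :: "'x list \<Rightarrow>\<^sub>0 'k"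
    using that keys_add[of p q] by blast
  have minus: "\<exists>q::'x list \<Rightarrow>\<^sub>0 'k. Poly_Mapping.keys q \<subseteq> lists S \<and> p + q = 0"
    if "Poly_Mapping.keys p \<subseteq> lists S" for p :: "'x list \<Rightarrow>\<^sub>0 'k"
    using that by (intro exI[of _ "- p"]) (auto simp: in_keys_iff subset_iff)
  show ?thesis
    by (intro ringI abelian_groupI monoidI)
       (simp_all add: free_algebra_def times plus minus zero_list_def
         add.assoc add.commute mult.assoc distrib_left distrib_right del: lists_eq_set)
qed

lemma smult_quot_free_algebra:
  fixes I :: "('x list \<Rightarrow>\<^sub>0 'k::field) set" and S :: "'x set"
  defines "A \<equiv> free_algebra S :: ('k, 'x list \<Rightarrow>\<^sub>0 'k) module"
  assumes I: "ideal I A" and p: "p \<in> carrier A"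
  shows "c \<odot>\<^bsub>quot_algebra A I\<^esub> (I +>\<^bsub>A\<^esub> p) = I +>\<^bsub>A\<^esub> (c \<odot>\<^bsub>A\<^esub> p)"
proof -
  interpret ideal I A by fact
  define e where "e = Poly_Mapping.single ([] :: 'x list) c"
  have e: "e \<in> carrier A" by (auto simp: A_def free_algebra_def e_def)
  have smult: "c \<odot>\<^bsub>A\<^esub> x = e \<otimes>\<^bsub>A\<^esub> x" for x
    by (simp add: A_def free_algebra_def e_def)
  have "I +>\<^bsub>A\<^esub> (e \<otimes>\<^bsub>A\<^esub> x) = I +>\<^bsub>A\<^esub> (e \<otimes>\<^bsub>A\<^esub> p)" if x: "x \<in> I +>\<^bsub>A\<^esub> p" for x
  proof -
    have xc: "x \<in> carrier A" using x p a_r_coset_subset_G[OF a_subset] by blast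
    have "I +>\<^bsub>A\<^esub> x = I +>\<^bsub>A\<^esub> p" using a_repr_independence[OF x p a_subgroup] by simp
    then show ?thesis
      using rcoset_mult_add[OF e xc] rcoset_mult_add[OF e p] by simp
  qed
  moreover have "p \<in> I +>\<^bsub>A\<^esub> p" by (rule a_rcos_self[OF p])
  ultimately have "(\<Union>x\<in>I +>\<^bsub>A\<^esub> p. I +>\<^bsub>A\<^esub> (e \<otimes>\<^bsub>A\<^esub> x)) = I +>\<^bsub>A\<^esub> (e \<otimes>\<^bsub>A\<^esub> p)"
    by blast
  then show ?thesis
    by (simp add: quot_algebra_def ring.defs module.defs smult)
qed


section \<open>Automorphisms of algebras\<close>

definition algebra_auto :: "('k, 'a, 'm) module_scheme \<Rightarrow> ('a \<Rightarrow> 'a) set" where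
  "algebra_auto A =
    {h \<in> ring_hom A A \<inter> Bij (carrier A).
      \<forall>c. \<forall>x\<in>carrier A. h (c \<odot>\<^bsub>A\<^esub> x) = c \<odot>\<^bsub>A\<^esub> h x}"

definition algebra_AutoGroup :: "('k, 'a, 'm) module_scheme \<Rightarrow> ('a \<Rightarrow> 'a) monoid" where
  "algebra_AutoGroup A = BijGroup (carrier A) \<lparr>carrier := algebra_auto A\<rparr>"

lemma subgroup_algebra_auto:
  fixes A :: "('k, 'a, 'm) module_scheme"
  assumes A: "ring A" and smult: "\<And>c x. x \<in> carrier A \<Longrightarrow> c \<odot>\<^bsub>A\<^esub> x \<in> carrier A"
  shows "subgroup (algebra_auto A) (BijGroup (carrier A))"
proof (rule subgroup.intro)
  interpret ring A by fact
  show "algebra_auto A \<subseteq> carrier (BijGroup (carrier A))"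
    by (auto simp: algebra_auto_def BijGroup_def)
  show "\<one>\<^bsub>BijGroup (carrier A)\<^esub> \<in> algebra_auto A"
    by (auto simp: algebra_auto_def BijGroup_def id_Bij ring_hom_def smult)
  show "g \<otimes>\<^bsub>BijGroup (carrier A)\<^esub> h \<in> algebra_auto A"
    if "g \<in> algebra_auto A" "h \<in> algebra_auto A" for g h
  proof -
    have "compose (carrier A) g h \<in> ring_hom A A"
      using that by (auto simp: algebra_auto_def ring_hom_def compose_def Pi_iff)
    moreover have "compose (carrier A) g h \<in> Bij (carrier A)"
      using that by (auto simp: algebra_auto_def intro: compose_Bij)
    moreover have "compose (carrier A) g h (c \<odot>\<^bsub>A\<^esub> x) = c \<odot>\<^bsub>A\<^esub> compose (carrier A) g h x"
      if "x \<in> carrier A" for c x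
      using that \<open>g \<in> _\<close> \<open>h \<in> _\<close>
      by (auto simp: algebra_auto_def compose_def smult ring_hom_closed)
    ultimately have "compose (carrier A) g h \<in> algebra_auto A"
      by (simp add: algebra_auto_def)
    moreover have "g \<in> Bij (carrier A)" "h \<in> Bij (carrier A)"
      using that by (auto simp: algebra_auto_def)
    ultimately show ?thesis by (simp add: BijGroup_def)
  qed
  show "inv\<^bsub>BijGroup (carrier A)\<^esub> h \<in> algebra_auto A" if h: "h \<in> algebra_auto A" for h
  proof -
    have hom: "h \<in> ring_hom A A" and Bij: "h \<in> Bij (carrier A)"
      and lin: "\<And>c x. x \<in> carrier A \<Longrightarrow> h (c \<odot>\<^bsub>A\<^esub> x) = c \<odot>\<^bsub>A\<^esub> h x"
      using h by (auto simp: algebra_auto_def)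
    define g where "g = restrict (inv_into (carrier A) h) (carrier A)"
    have bij: "bij_betw h (carrier A) (carrier A)" using Bij by (simp add: Bij_def)
    have g_in: "g x \<in> carrier A" and hg: "h (g x) = x" if "x \<in> carrier A" for x
      using that Bij bij by (auto simp: g_def Bij_inv_into_mem bij_betw_inv_into_right)
    have eq: "g y = x" if "x \<in> carrier A" "h x = y" for x y
      using that bij by (auto simp: g_def bij_betw_inv_into_left bij_betw_apply)
    have "g \<in> ring_hom A A"
      using hom by (intro ring_hom_memI eq) (auto simp: g_in hg ring_hom_mult ring_hom_add ring_hom_one)
    moreover have "g (c \<odot>\<^bsub>A\<^esub> x) = c \<odot>\<^bsub>A\<^esub> g x" if "x \<in> carrier A" for c x
      using that by (intro eq) (auto simp: smult g_in hg lin)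
    moreover have "g \<in> Bij (carrier A)" unfolding g_def by (rule restrict_inv_into_Bij[OF Bij])
    ultimately show ?thesis
      by (simp add: inv_BijGroup[OF Bij] algebra_auto_def flip: g_def)
  qed
qed

lemma group_algebra_AutoGroup:
  fixes A :: "('k, 'a, 'm) module_scheme"
  assumes "ring A" and "\<And>c x. x \<in> carrier A \<Longrightarrow> c \<odot>\<^bsub>A\<^esub> x \<in> carrier A"
  shows "group (algebra_AutoGroup A)"
  unfolding algebra_AutoGroup_def
  by (rule subgroup.subgroup_is_group[OF subgroup_algebra_auto[OF assms] group_BijGroup])


section \<open>The algebras \<open>V\<^sub>n(\<A>)\<close>\<close>

definition V_relations :: "nat \<Rightarrow> (nat \<Rightarrow> nat \<Rightarrow> 'k) \<Rightarrow> (nat list \<Rightarrow>\<^sub>0 'k::field) set" where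
  "V_relations n a =
    {Poly_Mapping.single [i] 1 * Poly_Mapping.single [j] 1 +
     Poly_Mapping.single [j] 1 * Poly_Mapping.single [i] 1 -
     Poly_Mapping.single [] (a i j) | i j. 1 \<le> i \<and> i < j \<and> j \<le> n}"

definition V_algebra ::
    "nat \<Rightarrow> (nat \<Rightarrow> nat \<Rightarrow> 'k) \<Rightarrow> ('k::field, (nat list \<Rightarrow>\<^sub>0 'k) set) module" where
  "V_algebra n a =
    quot_algebra (free_algebra {1..n}) (Idl\<^bsub>free_algebra {1..n}\<^esub> (V_relations n a))"


section \<open>Containing a free group\<close>

definition contains_free_group :: "('g, 'm) monoid_scheme \<Rightarrow> 'x set \<Rightarrow> bool" where
  "contains_free_group G S \<longleftrightarrow> (\<exists>H. subgroup H G \<and> G\<lparr>carrier := H\<rparr> \<cong> free_group S)"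

end

theory Submission
  imports Defs "HOL-Computational_Algebra.Formal_Laurent_Series"
begin

text \<open>
  Read the algebra as a Clifford algebra whose vectors are the combinations of the generators, and let
  \<open>w\<close> be the wedge product of the last \<open>n - 2\<close> generators, up to a power of 2. As \<open>n - 2\<close> is odd,
  \<open>[w, x\<^sub>2] = w x\<^sub>2 - x\<^sub>2 w\<close> is a wedge product too, of \<open>n - 1\<close> generators, and a wedge product of an
  even number of vectors anticommutes with each of them (\<open>anticommute_wedge\<close>). Squares of
  generators are central, so \<open>x\<^sub>1 \<mapsto> x\<^sub>1 + p [w, x\<^sub>2]\<close> with \<open>p\<close> a polynomial in \<open>x\<^sub>3\<^sup>2\<close> respects
  the relations, and fixing the other generators it is an automorphism, with inverse given by \<open>- p\<close>.
  Let \<open>\<phi>\<^sub>p\<close> be this shear and \<open>\<psi>\<^sub>p\<close> the one with the roles of \<open>x\<^sub>1\<close> and \<open>x\<^sub>2\<close> exchanged. Both fix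
  \<open>x\<^sub>3, \<dots>, x\<^sub>n\<close>, hence \<open>p\<close> and \<open>w\<close>, so they act on the pair \<open>(x\<^sub>1, x\<^sub>2)\<close> like the elementary
  matrices that add a multiple of one coordinate to the other.

  With \<open>p\<^sub>i = x\<^sub>3\<^bsup>2 i\<^esup>\<close> the automorphisms \<open>g\<^sub>i = \<phi>\<^sub>p \<psi>\<^sub>p\<close>, \<open>p = p\<^sub>i\<close>, for \<open>i \<in> \<nat>\<close> form a free
  family. In a reduced word, neighbouring letters produce alternating products of the \<open>\<phi>\<close> and \<open>\<psi>\<close>,
  except that \<open>g\<^sub>i\<close> next to the inverse of \<open>g\<^sub>j\<close> merges two shears of the same kind into one with
  coefficient \<open>\<plusminus>(p\<^sub>i - p\<^sub>j)\<close>; this is nonzero since \<open>i \<noteq> j\<close>. So no cancellation happens, and each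
  further shear makes the degree of one coordinate exceed that of the other, as in ping-pong for
  elementary matrices over a polynomial ring (\<open>state_same_side\<close>, \<open>state_other_side\<close>).

  To speak of degrees one needs to know that the algebra is not too small. For this it is mapped to
  Laurent series over the operators on the functions on sets of natural numbers. There
  Jordan-Wigner operators \<open>E\<^sub>j\<close> anticommute and square to 1, and there are annihilation operators whose
  anticommutator with \<open>E\<^sub>j\<close> is a scalar. With \<open>t\<close> the variable of the series,
  \<open>x\<^sub>j \<mapsto> t\<^sup>-\<^sup>1 E\<^sub>j + t N\<^sub>j\<close>, where \<open>N\<^sub>j\<close> is a suitable combination of annihilation operators, satisfies
  the defining relations for arbitrary scalars \<open>a\<^sub>i\<^sub>j\<close> (\<open>rep_gen_relation\<close>). The order of the pole is
  the degree, and the leading coefficients are, up to sign and powers of 2, products of the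
  \<open>E\<^sub>j\<close>, which can be cancelled because 2 is invertible: as \<open>n \<ge> 3\<close>, it divides \<open>(n - 1)!\<close>.
\<close>

section \<open>Free subgroups\<close>

definition letter_value :: "('g, 'm) monoid_scheme \<Rightarrow> ('s \<Rightarrow> 'g) \<Rightarrow> 's \<times> bool \<Rightarrow> 'g" where
  "letter_value G g x = (if snd x then g (fst x) else inv\<^bsub>G\<^esub> g (fst x))"

definition word_value :: "('g, 'm) monoid_scheme \<Rightarrow> ('s \<Rightarrow> 'g) \<Rightarrow> ('s \<times> bool) list \<Rightarrow> 'g" where
  "word_value G g w = foldr (\<lambda>x y. letter_value G g x \<otimes>\<^bsub>G\<^esub> y) w \<one>\<^bsub>G\<^esub>"

lemma word_value_Nil [simp]: "word_value G g [] = \<one>\<^bsub>G\<^esub>"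
  and word_value_Cons [simp]: "word_value G g (x # w) = letter_value G g x \<otimes>\<^bsub>G\<^esub> word_value G g w"
  by (simp_all add: word_value_def)

text \<open>
  The value of a word is unchanged by reduction, so it is a homomorphism on the free group; the
  hypothesis says that its kernel is trivial. Injectivity for any set of letters is therefore a matter
  of single reduced words, which is what makes the argument the same for two and for countably many
  generators.
\<close>

lemma contains_free_groupI:
  fixes G :: "('g, 'm) monoid_scheme" (structure)
  assumes G: "group G" and g: "\<And>s. s \<in> S \<Longrightarrow> g s \<in> carrier G"
    and nontrivial: "\<And>w. w \<in> lists (S \<times> UNIV) \<Longrightarrow> reduced w \<Longrightarrow> w \<noteq> [] \<Longrightarrow> word_value G g w \<noteq> \<one>\<^bsub>G\<^esub>"
  shows "contains_free_group G S"
proof -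
  interpret group G by fact
  let ?v = "word_value G g" and ?F = "free_group S"
  interpret F: group ?F by (rule group_free_group)
  have letter: "letter_value G g x \<in> carrier G" if "x \<in> S \<times> UNIV" for x
    using that g by (auto simp: letter_value_def)
  have closed: "?v w \<in> carrier G" if "w \<in> lists (S \<times> UNIV)" for w
    using that by induction (auto intro: letter)
  have cons: "?v (cons_reduce x w) = letter_value G g x \<otimes> ?v w"
    if "x \<in> S \<times> UNIV" "w \<in> lists (S \<times> UNIV)" for x w
  proof (cases w)
    case (Cons y ys)
    show ?thesis
    proof (cases "cancelling x y")
      case True
      then have "letter_value G g x \<otimes> letter_value G g y = \<one>"
        using that Cons g by (auto simp: cancelling_def letter_value_def)
      then have "letter_value G g x \<otimes> (letter_value G g y \<otimes> ?v ys) = ?v ys"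
        using that Cons letter closed by (simp flip: m_assoc)
      with True Cons show ?thesis by simp
    qed (use Cons in simp)
  qed (use that letter in simp)
  have append: "?v (foldr cons_reduce u w) = ?v u \<otimes> ?v w"
    if "u \<in> lists (S \<times> UNIV)" "w \<in> lists (S \<times> UNIV)" for u w
    using that(1)
  proof induction
    case (Cons x u)
    then have "foldr cons_reduce u w \<in> lists (S \<times> UNIV)" using that(2) by (intro lists_foldr) auto
    with Cons show ?case using that(2) letter closed by (simp add: cons m_assoc del: in_lists_conv_set)
  qed (use that closed in simp)
  have hom: "group_hom ?F G ?v"
    by unfold_locales (auto simp: hom_def free_group_def closed append simp del: in_lists_conv_set)
  then interpret h: group_hom ?F G ?v .
  have "inj_on ?v (carrier ?F)"
    unfolding h.inj_iff_trivial_ker using nontrivial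
    by (auto simp: kernel_def free_group_def)
  then have "?v \<in> iso ?F (G\<lparr>carrier := ?v ` carrier ?F\<rparr>)"
    using h.homh by (auto simp: iso_def bij_betw_def hom_def)
  then have "?F \<cong> G\<lparr>carrier := ?v ` carrier ?F\<rparr>" by (auto simp: is_iso_def)
  then show ?thesis
    unfolding contains_free_group_def using h.img_is_subgroup F.iso_sym by blast
qed

section \<open>Wedge products in rings\<close>

text \<open>
  In a Clifford algebra a vector \<open>x\<close> and a product \<open>w\<close> of \<open>k\<close> vectors satisfy
  \<open>w x + (-1)\<^sup>k x w = 2 (w \<and> x)\<close>, so this recursion computes the wedge product up to a power of 2
  and avoids the sum over all permutations.
\<close>

primrec wedge :: "'r::ring_1 list \<Rightarrow> 'r" where
  "wedge [] = 1"
| "wedge (x # xs) = wedge xs * x + (- 1) ^ length xs * (x * wedge xs)"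

lemma sign_cases: "(- 1) ^ k = (1 :: 'r::ring_1) \<or> (- 1) ^ k = (- 1 :: 'r)"
  by (induction k) auto

lemma wedge_anticommute_outside:
  fixes y :: "'r::ring_1"
  assumes "\<And>x. x \<in> set xs \<Longrightarrow> y * x = - (x * y)"
  shows "y * wedge xs = (- 1) ^ length xs * (wedge xs * y)"
  using assms
proof (induction xs)
  case (Cons x xs)
  define s :: 'r where "s = (- 1) ^ length xs"
  have s: "s = 1 \<or> s = - 1" unfolding s_def by (rule sign_cases)
  have IH: "y * wedge xs = s * (wedge xs * y)" using Cons by (simp add: s_def)
  have x: "y * x = - (x * y)" using Cons by simp
  have "y * (wedge xs * x) = (y * wedge xs) * x"
    by (simp add: mult.assoc)
  also have "\<dots> = - (s * (wedge xs * (x * y)))" by (simp add: IH x mult.assoc)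
  finally have left: "y * (wedge xs * x) = - (s * (wedge xs * (x * y)))" .
  have "y * (x * wedge xs) = (y * x) * wedge xs" by (simp add: mult.assoc)
  also have "\<dots> = - (x * (s * (wedge xs * y)))" by (simp add: x IH mult.assoc)
  finally have right: "y * (x * wedge xs) = - (x * (s * (wedge xs * y)))" .
  from s show ?case
    by (elim disjE) (simp_all add: left right mult.assoc algebra_simps flip: s_def)
qed simp

lemma wedge_map_hom:
  assumes "\<And>p q. h (p + q) = h p + h q" "\<And>p q. h (p * q) = h p * h q" "h 1 = 1"
  shows "h (wedge xs) = wedge (map h xs)"
proof -
  have "h 0 = 0" using assms(1)[of 0 0] by simp
  then have "h (- p) = - h p" for p using assms(1)[of "- p" p] by (simp add: eq_neg_iff_add_eq_0)
  then have "h ((- 1) ^ k) = (- 1) ^ k" for k by (induction k) (simp_all add: assms)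
  then show ?thesis by (induction xs) (simp_all add: assms)
qed

section \<open>Rings modulo an ideal\<close>

text \<open>
  Computations modulo relations are carried out in the ring \<open>'r\<close> itself: a congruence is the statement
  that a difference lies in \<open>J\<close>. The subring \<open>C\<close> is there because the ideal of relations absorbs only
  polynomials in the generators of the algebra, whereas the free algebra on the type has more.
\<close>

locale two_sided_ideal =
  fixes C J :: "'r::ring_1 set"
  assumes C_one: "1 \<in> C" and C_diff: "\<And>p q. p \<in> C \<Longrightarrow> q \<in> C \<Longrightarrow> p - q \<in> C"
    and C_mult: "\<And>p q. p \<in> C \<Longrightarrow> q \<in> C \<Longrightarrow> p * q \<in> C"
    and J_zero: "0 \<in> J" and J_diff: "\<And>p q. p \<in> J \<Longrightarrow> q \<in> J \<Longrightarrow> p - q \<in> J"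
    and J_left: "\<And>p q. p \<in> C \<Longrightarrow> q \<in> J \<Longrightarrow> p * q \<in> J"
    and J_right: "\<And>p q. p \<in> J \<Longrightarrow> q \<in> C \<Longrightarrow> p * q \<in> J"
begin

lemma C_zero: "0 \<in> C" using C_diff[OF C_one C_one] by simp
lemma C_uminus: "p \<in> C \<Longrightarrow> - p \<in> C" using C_diff[OF C_zero] by simp
lemma C_add: "p \<in> C \<Longrightarrow> q \<in> C \<Longrightarrow> p + q \<in> C" using C_diff[OF _ C_uminus] by simp
lemma J_uminus: "p \<in> J \<Longrightarrow> - p \<in> J" using J_diff[OF J_zero] by simp
lemma J_add: "p \<in> J \<Longrightarrow> q \<in> J \<Longrightarrow> p + q \<in> J" using J_diff[OF _ J_uminus] by simp
lemma C_power: "p \<in> C \<Longrightarrow> p ^ k \<in> C" by (induction k) (auto intro: C_one C_mult)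

lemma C_wedge: "set xs \<subseteq> C \<Longrightarrow> wedge xs \<in> C"
  by (induction xs) (auto intro!: C_one C_add C_mult C_power C_uminus)

lemma commute_mult:
  assumes "z * p - p * z \<in> J" "z * q - q * z \<in> J" "p \<in> C" "q \<in> C"
  shows "z * (p * q) - p * q * z \<in> J"
proof -
  have "z * (p * q) - p * q * z = (z * p - p * z) * q + p * (z * q - q * z)"
    by (simp add: algebra_simps)
  with assms show ?thesis by (auto intro: J_add J_left J_right)
qed

lemma commute_add:
  assumes "z * p - p * z \<in> J" "z * q - q * z \<in> J"
  shows "z * (p + q) - (p + q) * z \<in> J"
proof -
  have "z * (p + q) - (p + q) * z = (z * p - p * z) + (z * q - q * z)"
    by (simp add: algebra_simps)
  with assms show ?thesis by (auto intro: J_add)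
qed

lemma commute_wedge:
  assumes "\<And>x. x \<in> set xs \<Longrightarrow> z * x - x * z \<in> J" "set xs \<subseteq> C"
  shows "z * wedge xs - wedge xs * z \<in> J"
  using assms
proof (induction xs)
  case (Cons x xs)
  then have IH: "z * wedge xs - wedge xs * z \<in> J" by simp
  have "z * (- 1) ^ k - (- 1) ^ k * z \<in> J" for k
    using sign_cases[of k, where 'r = 'r] by (auto simp: J_zero)
  with Cons IH show ?case
    by (auto intro!: commute_add commute_mult C_wedge C_mult C_power C_uminus C_one)
qed (simp add: J_zero)

definition scalar_anticommutator :: "'r \<Rightarrow> 'r \<Rightarrow> bool" where
  "scalar_anticommutator x y \<longleftrightarrow> (\<exists>c. (\<forall>z. c * z = z * c) \<and> x * y + y * x - c \<in> J)"

text \<open>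
  With \<open>x y = c - y x\<close>, moving \<open>y\<close> past two factors \<open>x\<close> changes the sign twice, and the two terms
  with the central element \<open>c\<close> cancel.
\<close>

lemma square_commutes:
  assumes "scalar_anticommutator x y" "x \<in> C"
  shows "x * x * y - y * (x * x) \<in> J"
proof -
  obtain c where c: "\<And>z. c * z = z * c" and r: "x * y + y * x - c \<in> J"
    using assms by (auto simp: scalar_anticommutator_def)
  have "x * x * y - y * (x * x) = x * (x * y + y * x - c) - (x * y + y * x - c) * x"
    using c[of x] by (simp add: algebra_simps)
  with r assms show ?thesis by (auto intro: J_diff J_left J_right)
qed

text \<open>
  The Clifford identity \<open>y w = \<plusminus> w y\<close> for a vector \<open>y\<close> that occurs in the wedge product \<open>w\<close>: the
  part \<open>y \<and> w\<close>, which would enter with the other sign, vanishes. For the vector that the recursion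
  adds last it follows from the centrality of its square, for the others from the induction hypothesis
  and the scalar anticommutator with the last one.
\<close>

lemma anticommute_wedge:
  assumes "sorted_wrt scalar_anticommutator xs" "set xs \<subseteq> C" "y \<in> set xs"
  shows "y * wedge xs + (- 1) ^ length xs * (wedge xs * y) \<in> J"
  using assms
proof (induction xs)
  case (Cons x xs)
  define s :: 'r where "s = (- 1) ^ length xs"
  have s: "s = 1 \<or> s = - 1" unfolding s_def by (rule sign_cases)
  define w where "w = wedge xs"
  have w: "w \<in> C" unfolding w_def using Cons by (intro C_wedge) auto
  have x: "x \<in> C" using Cons by simp
  have scalar: "scalar_anticommutator x z" if "z \<in> set xs" for z using Cons that by simp
  have "y * wedge (x # xs) - s * (wedge (x # xs) * y) \<in> J"
  proof (cases "y \<in> set xs")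
    case True
    define h where "h = y * w + s * (w * y)"
    have h: "h \<in> J" unfolding h_def w_def s_def using Cons True by simp
    obtain c where c: "\<And>z. c * z = z * c" and r: "x * y + y * x - c \<in> J"
      using scalar[OF True] by (auto simp: scalar_anticommutator_def)
    define r' where "r' = x * y + y * x - c"
    (* the certificate: both sides expand to the same words once s * s = 1 and c is moved to the left *)
    have "y * wedge (x # xs) - s * (wedge (x # xs) * y) = h * x + s * (r' * w - w * r' - x * h)"
      using s c[of w] unfolding h_def r'_def
      by (elim disjE) (simp_all add: algebra_simps flip: w_def s_def)
    also have "\<dots> \<in> J"
    proof (intro J_add J_right[OF h x])
      have "r' * w - w * r' - x * h \<in> J"
        using h r w x by (auto simp flip: r'_def intro: J_diff J_left J_right)
      from this J_uminus[OF this] s show "s * (r' * w - w * r' - x * h) \<in> J"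
        by auto
    qed
    finally show ?thesis .
  next
    case False
    with Cons have y: "y = x" by simp
    have "x * x * w - w * (x * x) \<in> J"
      unfolding w_def using square_commutes[OF scalar x] Cons by (intro commute_wedge) auto
    moreover from this have "- (x * x * w - w * (x * x)) \<in> J" by (rule J_uminus)
    moreover have "y * wedge (x # xs) - s * (wedge (x # xs) * y) = s * (x * x * w - w * (x * x))"
      using s unfolding y by (elim disjE) (simp_all add: algebra_simps flip: w_def s_def)
    ultimately show ?thesis using s by auto
  qed
  then show ?case by (simp add: s_def)
qed simp

end

unbundle fps_syntax

section \<open>Leading terms of Laurent series\<close>

text \<open>
  A Laurent series in \<open>t\<close> is regarded as having degree at most \<open>d\<close> when its lowest exponent is at
  least \<open>- d\<close>. The coefficient \<open>a\<close> may be 0: this is what lets upper bounds and exact degrees be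
  handled by one predicate, and makes it multiplicative over rings with zero divisors.
\<close>

definition leading :: "int \<Rightarrow> 'r::ring_1 fls \<Rightarrow> 'r \<Rightarrow> bool" where
  "leading d A a \<longleftrightarrow> (\<forall>i < - d. A $$ i = 0) \<and> A $$ (- d) = a"

lemma leading_unique: "leading d A a \<Longrightarrow> leading d A b \<Longrightarrow> a = b"
  by (simp add: leading_def)

lemma leading_less: "leading d A a \<Longrightarrow> d < e \<Longrightarrow> leading e A 0"
  by (simp add: leading_def)

lemma leading_add: "leading d A a \<Longrightarrow> leading d B b \<Longrightarrow> leading d (A + B) (a + b)"
  by (simp add: leading_def)

lemma leading_diff: "leading d A a \<Longrightarrow> leading d B b \<Longrightarrow> leading d (A - B) (a - b)"
  by (simp add: leading_def)

lemma leading_uminus: "leading d A a \<Longrightarrow> leading d (- A) (- a)"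
  by (simp add: leading_def)

lemma leading_one: "leading 0 1 1"
  by (simp add: leading_def)

lemma leading_mult:
  assumes A: "leading d A a" and B: "leading e B b"
  shows "leading (d + e) (A * B) (a * b)"
proof -
  define p q where "p = fls_subdegree A" and "q = fls_subdegree B"
  have A0: "A $$ i = 0" if "i < - d \<or> i < p" for i
    using A that by (auto simp: leading_def p_def)
  have B0: "B $$ i = 0" if "i < - e \<or> i < q" for i
    using B that by (auto simp: leading_def q_def)
  have nth: "(A * B) $$ i = (\<Sum>j=p + q..i. A $$ (j - q) * B $$ (q + i - j))" for i
    unfolding p_def q_def by (rule fls_times_nth)
  have "(A * B) $$ i = 0" if "i < - (d + e)" for i
    unfolding nth
  proof (intro sum.neutral ballI)
    fix j
    show "A $$ (j - q) * B $$ (q + i - j) = 0"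
      using that A0[of "j - q"] B0[of "q + i - j"] by (cases "j - q < - d") auto
  qed
  moreover have "(A * B) $$ (- (d + e)) = a * b"
  proof -
    have "A $$ (j - q) * B $$ (q + - (d + e) - j) = (if j = q - d then a * b else 0)" for j
      using A B A0[of "j - q"] B0[of "q + - (d + e) - j"]
      by (cases "j - q < - d") (auto simp: leading_def)
    then have "(A * B) $$ (- (d + e)) = (\<Sum>j=p + q..- (d + e). if j = q - d then a * b else 0)"
      unfolding nth by simp
    also have "\<dots> = a * b"
      using A B A0[of "- d"] B0[of "- e"] by (auto simp: leading_def)
    finally show ?thesis .
  qed
  ultimately show ?thesis by (simp add: leading_def)
qed

lemma leading_power: "leading d A a \<Longrightarrow> leading (int k * d) (A ^ k) (a ^ k)"
  by (induction k) (auto simp: leading_one distrib_right intro: leading_mult)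

lemma leading_wedge:
  assumes "\<And>j. j \<in> set js \<Longrightarrow> leading 1 (x j) (E j)"
  shows "leading (int (length js)) (wedge (map x js)) (wedge (map E js))"
  using assms
proof (induction js)
  case (Cons j js)
  let ?x = "wedge (map x js)" and ?E = "wedge (map E js)" and ?m = "int (length js)"
  have x: "leading ?m ?x ?E" and j: "leading 1 (x j) (E j)" using Cons by auto
  have "leading (int (length js) * 0) ((- 1) ^ length js) ((- 1) ^ length js)"
    by (intro leading_power leading_uminus leading_one)
  from leading_mult[OF this leading_mult[OF j x]]
  have "leading (?m + 1) ((- 1) ^ length js * (x j * ?x)) ((- 1) ^ length js * (E j * ?E))"
    by (simp add: add.commute)
  with leading_mult[OF x j] show ?case by (auto simp: add.commute[of 1] intro: leading_add)
qed (simp add: leading_one)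

section \<open>Growth of leading degrees\<close>

text \<open>
  Here \<open>W\<close> plays the role of the image of \<open>w\<close>. An element whose leading coefficient anticommutes with
  the leading coefficient \<open>\<omega>\<close> of \<open>W\<close> has no cancellation in the leading term of its commutator with
  \<open>W\<close>, provided that \<open>\<omega>\<close> and 2 are not zero divisors.
\<close>

locale growth =
  fixes W :: "'r::ring_1 fls" and \<omega> :: 'r and m :: int
  assumes W: "leading m W \<omega>" and m: "m > 0"
    and cancel: "\<And>b. \<omega> * b = 0 \<Longrightarrow> b = 0" and two: "\<And>b :: 'r. b + b = 0 \<Longrightarrow> b = 0"
begin

definition exact :: "int \<Rightarrow> 'r fls \<Rightarrow> bool" where
  "exact d A \<longleftrightarrow> (\<exists>a. leading d A a \<and> a \<noteq> 0 \<and> \<omega> * a = - (a * \<omega>))"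

definition unit_leading :: "'r fls \<Rightarrow> bool" where
  "unit_leading Q \<longleftrightarrow> (\<exists>e\<ge>0. leading e Q 1 \<or> leading e Q (- 1))"

definition L :: "'r fls \<Rightarrow> 'r fls" where "L A = W * A - A * W"

lemma unit_leading_uminus: "unit_leading Q \<Longrightarrow> unit_leading (- Q)"
  unfolding unit_leading_def using leading_uminus by force

text \<open>
  Since \<open>\<omega> a = - a \<omega>\<close>, the leading coefficient of the commutator is \<open>2 \<omega> a\<close>. It is nonzero and
  again anticommutes with \<open>\<omega>\<close>, so the step can be repeated.
\<close>

lemma exact_step:
  assumes A: "exact d A" and Q: "unit_leading Q" and Z: "leading d' Z z" and "d' \<le> d"
  obtains d'' where "d'' > d" "exact d'' (Z + Q * L A)"
proof -
  obtain a where a: "leading d A a" "a \<noteq> 0" and anti: "\<omega> * a = - (a * \<omega>)"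
    using A by (auto simp: exact_def)
  obtain e s where e: "e \<ge> 0" "leading e Q s" and s: "s = 1 \<or> s = - 1"
    using Q by (auto simp: unit_leading_def)
  define b where "b = \<omega> * a + \<omega> * a"
  have "leading (m + d) (L A) b"
    using leading_diff[OF leading_mult[OF W a(1)]] leading_mult[OF a(1) W] anti
    by (fastforce simp: L_def b_def add.commute)
  then have "leading (e + (m + d)) (Q * L A) (s * b)"
    using e leading_mult by blast
  moreover have "leading (e + (m + d)) Z 0"
    using leading_less[OF Z] m e assms by simp
  ultimately have "leading (e + (m + d)) (Z + Q * L A) (s * b)"
    using leading_add by fastforce
  moreover have "b \<noteq> 0" using two cancel a(2) unfolding b_def by blast
  then have "s * b \<noteq> 0" using s by auto
  moreover have "\<omega> * (a * \<omega>) = - (a * (\<omega> * \<omega>))"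
    by (metis anti mult.assoc mult_minus_left)
  then have "\<omega> * b = - (b * \<omega>)"
    by (simp add: b_def anti algebra_simps)
  then have "\<omega> * (s * b) = - (s * b * \<omega>)" using s by auto
  ultimately have "exact (e + (m + d)) (Z + Q * L A)" by (auto simp: exact_def)
  with that[of "e + (m + d)"] m e show thesis by simp
qed

text \<open>
  The ping-pong invariant after a letter with coefficient \<open>Q\<close>: the larger coordinate is \<open>B\<close>, and the
  equation for \<open>B\<close> records the last shear, so that a following shear of the same coordinate can be
  merged with it. The bound \<open>d > 1\<close> distinguishes \<open>A\<close> from a generator, which has degree 1.
\<close>

definition state :: "'r fls \<Rightarrow> 'r fls \<Rightarrow> 'r fls \<Rightarrow> bool" where
  "state A B Q \<longleftrightarrow> (\<exists>d>1. exact d A \<and> (\<exists>d'\<le>d. \<exists>Z z. leading d' Z z \<and> B = Z + Q * L A))"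

lemma state_advance:
  assumes A: "leading d A a" and B: "exact d' B" and "d \<le> d'" "1 \<le> d'" and Q: "unit_leading Q"
    and A': "A' = A + Q * L B" and B': "B' = B + Q * L A'"
  shows "state A' B' Q"
proof -
  obtain d'' where "d'' > d'" "exact d'' A'"
    using exact_step[OF B Q A] assms by blast
  moreover obtain b where "leading d' B b" using B by (auto simp: exact_def)
  ultimately show ?thesis unfolding state_def B' using assms
    by (intro exI[of _ d'']) (auto intro!: exI[of _ d'])
qed

lemma state_start:
  assumes "exact 1 A" "exact 1 B" "unit_leading Q" "A' = A + Q * L B" "B' = B + Q * L A'"
  shows "state A' B' Q"
  using assms state_advance[of 1 A _ 1 B] by (auto simp: exact_def)

text \<open>
  A letter of the same sign as its predecessor starts with the coordinate \<open>A\<close>, which was not the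
  last to be sheared, so the shears alternate.
\<close>

lemma state_same_side:
  assumes S: "state A B Q" and Q: "unit_leading Q" and Q': "unit_leading Q'"
    and A': "A' = A + Q' * L B" and B': "B' = B + Q' * L A'"
  shows "state A' B' Q'"
proof -
  obtain d d' Z z where d: "d > 1" "exact d A" "d' \<le> d" "leading d' Z z" "B = Z + Q * L A"
    using S by (auto simp: state_def)
  obtain d'' where "d'' > d" "exact d'' B" using exact_step[OF d(2) Q d(4,3)] d(5) by blast
  moreover obtain a where "leading d A a" using d by (auto simp: exact_def)
  ultimately show ?thesis using state_advance[OF _ _ _ _ Q' A' B'] d by force
qed

text \<open>
  A letter of the opposite sign first shears the coordinate that has just been sheared. Both shears
  together have the coefficient \<open>Q + Q'\<close>, and growth resumes unless it vanishes.
\<close>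

lemma state_other_side:
  assumes S: "state A B Q" and Q: "unit_leading (Q + Q')" and Q': "unit_leading Q'"
    and B': "B' = B + Q' * L A" and A': "A' = A + Q' * L B'"
  shows "state B' A' Q'"
proof -
  obtain d d' Z z where d: "d > 1" "exact d A" "d' \<le> d" "leading d' Z z" "B = Z + Q * L A"
    using S by (auto simp: state_def)
  have "B' = Z + (Q + Q') * L A" unfolding B' d(5) by (simp add: distrib_right add.assoc)
  then obtain d'' where "d'' > d" "exact d'' B'" using exact_step[OF d(2) Q d(4,3)] by metis
  moreover obtain a where "leading d A a" using d by (auto simp: exact_def)
  ultimately show ?thesis unfolding state_def A' using d
    by (intro exI[of _ d'']) (auto intro!: exI[of _ d])
qed

lemma state_neq:
  assumes "state A B Q" "leading 1 A a"
  shows False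
  using assms leading_less leading_unique by (fastforce simp: state_def exact_def)

lemma unit_leading_power_diff:
  assumes "leading e Y 1" "e > 0" "i \<noteq> j"
  shows "unit_leading (Y ^ i - Y ^ j)"
proof -
  have *: "leading (int (max i j) * e) (Y ^ i - Y ^ j) (if i > j then 1 else - 1)"
  proof (cases "i > j")
    case True
    have "leading (int i * e) (Y ^ j) 0"
      using True assms leading_less[OF leading_power[OF assms(1), of j]] by simp
    then show ?thesis using True leading_diff[OF leading_power[OF assms(1), of i]] by fastforce
  next
    case False
    have "leading (int j * e) (Y ^ i) 0"
      using False assms leading_less[OF leading_power[OF assms(1), of i]] by simp
    then show ?thesis using False leading_diff[OF _ leading_power[OF assms(1), of j]] by fastforce
  qed
  moreover have "int (max i j) * e \<ge> 0" using assms by simp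
  ultimately show ?thesis unfolding unit_leading_def by (metis (full_types))
qed

lemma unit_leading_power:
  assumes "leading e Y 1" "e > 0"
  shows "unit_leading (Y ^ i)"
  using leading_power[OF assms(1), of i] assms(2) unfolding unit_leading_def
  by (intro exI[of _ "int i * e"]) auto

end

section \<open>A Clifford algebra of operators\<close>

text \<open>
  The functions on sets of natural numbers serve as a Fock space: the set lists the occupied places.
  Operators are required to be linear and not only additive so that scalars are central.
\<close>

typedef (overloaded) 'k::field operator =
  "{A :: (nat set \<Rightarrow> 'k) \<Rightarrow> nat set \<Rightarrow> 'k.
     (\<forall>f g. A (\<lambda>S. f S + g S) = (\<lambda>S. A f S + A g S)) \<and>
     (\<forall>c f. A (\<lambda>S. c * f S) = (\<lambda>S. c * A f S))}"
  by (rule exI[of _ "\<lambda>f. f"]) simp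

setup_lifting type_definition_operator

instantiation operator :: (field) ring_1
begin

lift_definition zero_operator :: "'a operator" is "\<lambda>f S. 0" by simp
lift_definition one_operator :: "'a operator" is "\<lambda>f. f" by simp
lift_definition plus_operator :: "'a operator \<Rightarrow> 'a operator \<Rightarrow> 'a operator"
  is "\<lambda>A B f S. A f S + B f S" by (auto simp: algebra_simps)
lift_definition minus_operator :: "'a operator \<Rightarrow> 'a operator \<Rightarrow> 'a operator"
  is "\<lambda>A B f S. A f S - B f S" by (auto simp: algebra_simps)
lift_definition uminus_operator :: "'a operator \<Rightarrow> 'a operator"
  is "\<lambda>A f S. - A f S" by (auto simp: algebra_simps)
lift_definition times_operator :: "'a operator \<Rightarrow> 'a operator \<Rightarrow> 'a operator"
  is "\<lambda>A B f. A (B f)" by simp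

instance
proof
  show "(0::'a operator) \<noteq> 1"
  proof (transfer, rule notI)
    assume "(\<lambda>f S. 0) = (\<lambda>f::nat set \<Rightarrow> 'a. f)"
    from fun_cong[OF fun_cong[OF this, of "\<lambda>S. 1"]] show False by simp
  qed
qed (transfer; simp add: fun_eq_iff algebra_simps)+

end

lift_definition scalar :: "'k::field \<Rightarrow> 'k operator" is "\<lambda>c f S. c * f S"
  by (simp add: algebra_simps)

lemma scalar_central: "scalar c * A = A * scalar c"
  by transfer auto

lemma scalar_add: "scalar (c + d) = scalar c + scalar d"
  and scalar_mult: "scalar (c * d) = scalar c * scalar d"
  and scalar_one: "scalar 1 = 1" and scalar_zero: "scalar 0 = 0"
  by (transfer; simp add: algebra_simps)+

definition toggle :: "nat \<Rightarrow> nat set \<Rightarrow> nat set" where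
  "toggle j S = (if j \<in> S then S - {j} else insert j S)"

text \<open>
  The Jordan-Wigner sign, the parity of the number of occupied places before \<open>j\<close>. It is a finite
  product for every set, so there is no restriction to finite sets.
\<close>

definition jw_sign :: "nat \<Rightarrow> nat set \<Rightarrow> 'k::field" where
  "jw_sign j S = (\<Prod>i<j. if i \<in> S then - 1 else 1)"

lemma toggle_toggle: "toggle j (toggle j S) = S"
  and toggle_commute: "toggle i (toggle j S) = toggle j (toggle i S)"
  and mem_toggle: "i \<in> toggle j S \<longleftrightarrow> (if i = j then i \<notin> S else i \<in> S)"
  by (auto simp: toggle_def)

lemma jw_sign_square: "jw_sign j S * jw_sign j S = 1"
  unfolding jw_sign_def prod.distrib[symmetric] by (intro prod.neutral) auto

lemma jw_sign_toggle: "jw_sign j (toggle i S) = (if i < j then - jw_sign j S else jw_sign j S)"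
proof -
  have "jw_sign j (toggle i S) = (\<Prod>l<j. (if l = i then - 1 else 1) * (if l \<in> S then - 1 else 1 :: 'a))"
    unfolding jw_sign_def by (intro prod.cong) (auto simp: mem_toggle)
  also have "\<dots> = (\<Prod>l<j. if l = i then - 1 else 1) * jw_sign j S"
    by (simp add: prod.distrib jw_sign_def)
  finally show ?thesis by simp
qed

lift_definition clifford :: "nat \<Rightarrow> 'k::field operator"
  is "\<lambda>j f S. jw_sign j S * f (toggle j S)"
  by (simp add: algebra_simps)

lift_definition vacant :: "nat \<Rightarrow> 'k::field operator"
  is "\<lambda>j f S. if j \<in> S then 0 else f S"
  by (auto simp: fun_eq_iff)

lemma clifford_square: "clifford j * clifford j = (1 :: 'k::field operator)"
  by transfer (simp add: jw_sign_toggle toggle_toggle jw_sign_square flip: mult.assoc)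

text \<open>
  Toggling the smaller of the two places changes the sign of the operator at the larger one, and not
  conversely.
\<close>

lemma clifford_anticommute: "i \<noteq> j \<Longrightarrow> clifford i * clifford j = - (clifford j * clifford i :: 'k::field operator)"
  by transfer (auto simp: fun_eq_iff jw_sign_toggle toggle_commute linorder_neq_iff)

lemma vacant_clifford: "clifford j * vacant j = (1 - vacant j) * (clifford j :: 'k::field operator)"
  by transfer (auto simp: fun_eq_iff mem_toggle)

lemma vacant_commute: "i \<noteq> j \<Longrightarrow> clifford i * vacant j = (vacant j * clifford i :: 'k::field operator)"
  by transfer (auto simp: fun_eq_iff mem_toggle)

lemma vacant_vacant: "vacant i * vacant j = (vacant j * vacant i :: 'k::field operator)"
  by transfer (auto simp: fun_eq_iff)

lemma vacant_idem: "vacant j * vacant j = (vacant j :: 'k::field operator)"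
  by transfer (auto simp: fun_eq_iff)

text \<open>
  \<open>clifford j\<close> is the sum of creation and annihilation at \<open>j\<close>, and the projection to the functions
  supported on sets without \<open>j\<close> picks out one of the two.
\<close>

definition annihilation :: "nat \<Rightarrow> 'k::field operator" where
  "annihilation j = vacant j * clifford j"

lemma clifford_annihilation:
  "clifford i * annihilation j + annihilation j * clifford i = (if i = j then 1 else 0 :: 'k::field operator)"
proof (cases "i = j")
  case True
  have "clifford j * annihilation j = (1 - vacant j :: 'k operator)"
    unfolding annihilation_def mult.assoc[symmetric] vacant_clifford
    by (simp add: mult.assoc clifford_square)
  moreover have "annihilation j * clifford j = (vacant j :: 'k operator)"
    unfolding annihilation_def by (simp add: mult.assoc clifford_square)
  ultimately show ?thesis using True by simp
next
  case False
  then have "clifford i * annihilation j = (vacant j * (clifford i * clifford j) :: 'k operator)"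
    by (simp add: annihilation_def vacant_commute flip: mult.assoc)
  with False show ?thesis
    by (simp add: annihilation_def clifford_anticommute[OF False] mult.assoc)
qed

lemma annihilation_anticommute:
  "annihilation i * annihilation j + annihilation j * annihilation i = (0 :: 'k::field operator)"
proof (cases "i = j")
  case True
  have "annihilation j * annihilation j = (vacant j * (1 - vacant j) * clifford j * clifford j :: 'k operator)"
    unfolding annihilation_def by (metis mult.assoc vacant_clifford)
  also have "\<dots> = 0" by (simp add: right_diff_distrib vacant_idem)
  finally show ?thesis using True by simp
next
  case False
  have *: "annihilation i * annihilation j = (vacant i * vacant j * (clifford i * clifford j) :: 'k operator)"
    if "i \<noteq> j" for i j
    unfolding annihilation_def by (metis mult.assoc vacant_commute[OF that])
  show ?thesis
    unfolding *[OF False] *[OF False[symmetric]] clifford_anticommute[OF False] vacant_vacant[of j i]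
    by simp
qed

lemma operator_double_eq_0:
  fixes b :: "'k::field operator"
  assumes "(2::'k) \<noteq> 0" "b + b = 0"
  shows "b = 0"
proof -
  have "scalar (1 / 2) * (b + b) = (scalar (1 / 2 + 1 / 2) :: 'k operator) * b"
    unfolding scalar_add by (simp add: distrib_left distrib_right)
  also have "(1 / 2 + 1 / 2 :: 'k) = 1" using assms(1) by (simp add: field_simps)
  finally show ?thesis using assms(2) by (simp add: scalar_one)
qed

text \<open>
  Distinct \<open>clifford j\<close> anticommute, so their wedge product is a power of 2 times their ordinary
  product, and each factor is its own inverse.
\<close>

lemma wedge_clifford_cancel:
  fixes b :: "'k::field operator"
  assumes "(2::'k) \<noteq> 0" "distinct js" "wedge (map clifford js) * b = 0"
  shows "b = 0"
  using assms(2,3)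
proof (induction js arbitrary: b)
  case (Cons j js)
  define w :: "'k operator" where "w = wedge (map clifford js)"
  define s :: "'k operator" where "s = (- 1) ^ length js"
  have s: "s = 1 \<or> s = - 1" unfolding s_def by (rule sign_cases)
  have "clifford j * w = s * (w * clifford j)"
    using wedge_anticommute_outside[of "map clifford js" "clifford j :: 'k operator"] Cons.prems
      clifford_anticommute[where 'k = 'k, of j]
    unfolding w_def s_def by fastforce
  then have "wedge (map clifford (j # js)) = w * clifford j + w * clifford j"
    using s by (auto simp: w_def s_def)
  then have "w * (clifford j * b + clifford j * b) = 0"
    using Cons.prems by (simp add: distrib_left distrib_right mult.assoc)
  then have "clifford j * b + clifford j * b = 0"
    using Cons by (simp add: w_def)
  then have "clifford j * (clifford j * b + clifford j * b) = 0" by simp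
  then have "b + b = 0"
    by (simp add: distrib_left clifford_square flip: mult.assoc)
  then show ?case using operator_double_eq_0 assms(1) by blast
qed simp

section \<open>Homomorphisms from free algebras\<close>

abbreviation gen :: "'x \<Rightarrow> 'x list \<Rightarrow>\<^sub>0 'k::field" where
  "gen i \<equiv> Poly_Mapping.single [i] 1"

abbreviation const :: "'k::field \<Rightarrow> 'x list \<Rightarrow>\<^sub>0 'k" where
  "const c \<equiv> Poly_Mapping.single [] c"

text \<open>
  The map \<open>e\<close> is the structure map of the target as an algebra over \<open>'k\<close>, so the last condition
  gives linearity and, as \<open>e\<close> preserves 1, also unitality.
\<close>

definition alg_hom :: "('k::field \<Rightarrow> 'b::ring_1) \<Rightarrow> (('x list \<Rightarrow>\<^sub>0 'k) \<Rightarrow> 'b) \<Rightarrow> bool" where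
  "alg_hom e h \<longleftrightarrow> (\<forall>p q. h (p + q) = h p + h q) \<and> (\<forall>p q. h (p * q) = h p * h q) \<and> (\<forall>c. h (const c) = e c)"

definition free_eval :: "('k::field \<Rightarrow> 'b::ring_1) \<Rightarrow> ('x \<Rightarrow> 'b) \<Rightarrow> ('x list \<Rightarrow>\<^sub>0 'k) \<Rightarrow> 'b" where
  "free_eval e y p = (\<Sum>w\<in>Poly_Mapping.keys p. e (Poly_Mapping.lookup p w) * prod_list (map y w))"

lemma const_one: "const 1 = 1"
  using single_one[where 'a = "'x list"] by (simp add: zero_list_def)

lemma single_Cons: "Poly_Mapping.single (i # w) (c :: 'k::field) = gen i * Poly_Mapping.single w c"
  by (simp add: mult_single plus_list_def)

lemma const_central: "const c * p = p * (const c :: 'x list \<Rightarrow>\<^sub>0 'k::field)"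
proof (induction p rule: update_induct)
  case (update p w b)
  then have "Poly_Mapping.update w b p = Poly_Mapping.single w b + p"
    by (intro poly_mapping_eqI) (auto simp: lookup_update lookup_add lookup_single when_def in_keys_iff)
  with update show ?case by (simp add: distrib_left distrib_right mult_single plus_list_def mult.commute)
qed simp

lemma free_algebra_induct [case_names zero add]:
  assumes "P 0" and add: "\<And>p w c. P p \<Longrightarrow> P (Poly_Mapping.single w c + p)"
  shows "P (p :: 'x list \<Rightarrow>\<^sub>0 'k::field)"
proof (induction p rule: update_induct)
  case (update p w b)
  then have "Poly_Mapping.update w b p = Poly_Mapping.single w b + p"
    by (intro poly_mapping_eqI) (auto simp: lookup_update lookup_add lookup_single when_def in_keys_iff)
  with update add show ?case by simp
qed (fact assms(1))

lemma alg_homD: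
  assumes "alg_hom e h"
  shows "h (p + q) = h p + h q" "h (p * q) = h p * h q" "h (const c) = e c"
    and "h 0 = 0" "h (- p) = - h p" "h (p - q) = h p - h q"
proof -
  show add: "h (p + q) = h p + h q" and "h (p * q) = h p * h q" "h (const c) = e c" for p q
    using assms by (auto simp: alg_hom_def)
  show zero: "h 0 = 0" using add[of 0 0] by simp
  show minus: "h (- p) = - h p" for p using add[of "- p" p] zero by (simp add: eq_neg_iff_add_eq_0)
  show "h (p - q) = h p - h q" using add[of p "- q"] minus by simp
qed

lemma alg_hom_eqI:
  assumes g: "alg_hom e g" and h: "alg_hom e h" and "\<And>i. g (gen i) = h (gen i)"
  shows "g = h"
proof
  fix p
  have "g (Poly_Mapping.single w c) = h (Poly_Mapping.single w c)" for w c
  proof (induction w)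
    case (Cons i w)
    then show ?case
      unfolding single_Cons[of i w] by (simp add: alg_homD(2)[OF g] alg_homD(2)[OF h] assms(3))
  qed (simp add: alg_homD(3)[OF g] alg_homD(3)[OF h])
  then show "g p = h p"
    by (induction p rule: free_algebra_induct) (simp_all add: alg_homD[OF g] alg_homD[OF h])
qed

locale scalar_embedding =
  fixes e :: "'k::field \<Rightarrow> 'b::ring_1"
  assumes e_add: "e (c + d) = e c + e d" and e_mult: "e (c * d) = e c * e d"
    and e_one: "e 1 = 1" and e_central: "e c * b = b * e c"
begin

lemma e_zero: "e 0 = 0" using e_add[of 0 0] by simp

lemma free_eval_superset:
  assumes "finite A" "Poly_Mapping.keys p \<subseteq> A"
  shows "free_eval e y p = (\<Sum>w\<in>A. e (Poly_Mapping.lookup p w) * prod_list (map y w))"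
  unfolding free_eval_def using assms
  by (intro sum.mono_neutral_left) (auto simp: in_keys_iff e_zero)

lemma free_eval_single: "free_eval e y (Poly_Mapping.single w c) = e c * prod_list (map y w)"
  by (subst free_eval_superset[of "{w}"]) auto

lemma free_eval_gen: "free_eval e y (gen i) = y i"
  by (simp add: free_eval_single e_one)

lemma free_eval_add: "free_eval e y (p + q) = free_eval e y p + free_eval e y q"
proof -
  let ?A = "Poly_Mapping.keys p \<union> Poly_Mapping.keys q"
  show ?thesis
    using keys_add[of p q]
    by (subst (1 2 3) free_eval_superset[of ?A])
       (auto simp: lookup_add e_add distrib_right sum.distrib)
qed

lemma free_eval_mult: "free_eval e y (p * q) = free_eval e y p * free_eval e y q"
proof (induction p rule: free_algebra_induct)
  case (add p u c)
  have "free_eval e y (Poly_Mapping.single u c * q) = free_eval e y (Poly_Mapping.single u c) * free_eval e y q"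
  proof (induction q rule: free_algebra_induct)
    case (add q v d)
    have "e c * e d * (prod_list (map y u) * prod_list (map y v)) =
        e c * prod_list (map y u) * (e d * prod_list (map y v))"
      by (metis e_central mult.assoc)
    with add show ?case
      by (simp add: distrib_left mult_single free_eval_add free_eval_single plus_list_def e_mult)
  qed (simp add: free_eval_def)
  with add show ?case by (simp add: distrib_right free_eval_add)
qed (simp add: free_eval_def)

lemma alg_hom_free_eval: "alg_hom e (free_eval e y)"
  by (simp add: alg_hom_def free_eval_add free_eval_mult free_eval_single)

end

abbreviation subst :: "('x \<Rightarrow> 'x list \<Rightarrow>\<^sub>0 'k::field) \<Rightarrow> ('x list \<Rightarrow>\<^sub>0 'k) \<Rightarrow> 'x list \<Rightarrow>\<^sub>0 'k" where
  "subst \<equiv> free_eval const"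

interpretation const: scalar_embedding "const :: 'k::field \<Rightarrow> 'x list \<Rightarrow>\<^sub>0 'k"
  by standard (simp_all add: single_add mult_single plus_list_def const_one const_central)

lemma alg_hom_comp:
  assumes "alg_hom e g" "alg_hom const h"
  shows "alg_hom e (g \<circ> h)"
  using assms by (simp add: alg_hom_def)

section \<open>Quotients of free algebras\<close>

text \<open>
  Throughout, \<open>C\<close> is the carrier as a set of the ambient type, so that its elements can be computed
  with by the type class operations.
\<close>

locale free_quotient =
  fixes S :: "'x set" and I :: "('x list \<Rightarrow>\<^sub>0 'k::field) set"
  assumes ideal: "ideal I (free_algebra S)"
begin

abbreviation F :: "('k, 'x list \<Rightarrow>\<^sub>0 'k) module" where "F \<equiv> free_algebra S"
abbreviation Q :: "('k, ('x list \<Rightarrow>\<^sub>0 'k) set) module" where "Q \<equiv> quot_algebra F I"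

definition C :: "('x list \<Rightarrow>\<^sub>0 'k) set" where "C = carrier F"
definition cls :: "('x list \<Rightarrow>\<^sub>0 'k) \<Rightarrow> ('x list \<Rightarrow>\<^sub>0 'k) set" where "cls p = I +>\<^bsub>F\<^esub> p"

sublocale ideal I F by (rule ideal)

lemma mem_C: "p \<in> C \<longleftrightarrow> Poly_Mapping.keys p \<subseteq> lists S"
  by (simp add: C_def free_algebra_def)

lemma F_simps: "x \<otimes>\<^bsub>F\<^esub> y = x * y" "x \<oplus>\<^bsub>F\<^esub> y = x + y" "\<one>\<^bsub>F\<^esub> = 1" "\<zero>\<^bsub>F\<^esub> = 0"
    "c \<odot>\<^bsub>F\<^esub> x = const c * x"
  by (simp_all add: free_algebra_def)

lemma F_uminus: assumes "p \<in> C" shows "\<ominus>\<^bsub>F\<^esub> p = - p"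
proof (rule minus_equality)
  show "- p \<oplus>\<^bsub>F\<^esub> p = \<zero>\<^bsub>F\<^esub>" by (simp add: F_simps)
  show "p \<in> carrier F" using assms by (simp add: C_def)
  show "- p \<in> carrier F" using assms by (simp add: mem_C flip: C_def)
qed

lemma F_minus: "p \<in> C \<Longrightarrow> q \<in> C \<Longrightarrow> p \<ominus>\<^bsub>F\<^esub> q = p - q"
  by (simp add: a_minus_def F_uminus F_simps)

lemma const_in_C: "const c \<in> C" by (simp add: mem_C)

lemma gen_in_C: "i \<in> S \<Longrightarrow> gen i \<in> C" by (simp add: mem_C)

lemma I_subset: "I \<subseteq> C" using a_subset by (simp add: C_def)

sublocale two_sided_ideal C I
proof
  show "1 \<in> C" using const_in_C[of 1] by (simp add: const_one)
  show diff: "p - q \<in> C" if "p \<in> C" "q \<in> C" for p q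
    using that F_minus[OF that] minus_closed[of p q] by (simp add: C_def)
  show "p * q \<in> C" if "p \<in> C" "q \<in> C" for p q
    using that m_closed[of p q] by (simp add: C_def F_simps)
  show "0 \<in> I" using additive_subgroup.zero_closed[OF additive_subgroup_axioms] by (simp add: F_simps)
  show "p - q \<in> I" if "p \<in> I" "q \<in> I" for p q
  proof -
    have "p \<in> C" "q \<in> C" using that I_subset by auto
    moreover have "p \<oplus>\<^bsub>F\<^esub> \<ominus>\<^bsub>F\<^esub> q \<in> I" using that 
      by (intro additive_subgroup.a_closed[OF additive_subgroup_axioms]
        additive_subgroup.a_inv_closed[OF additive_subgroup_axioms])
    ultimately show ?thesis by (simp add: F_uminus F_simps)
  qed
  show "p * q \<in> I" if "p \<in> C" "q \<in> I" for p q
    using that I_l_closed[of q p] by (simp add: C_def F_simps)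
  show "p * q \<in> I" if "p \<in> I" "q \<in> C" for p q
    using that I_r_closed[of p q] by (simp add: C_def F_simps)
qed

lemma carrier_Q: "carrier Q = cls ` C"
  by (auto simp: quot_algebra_def ring.defs module.defs FactRing_def A_RCOSETS_def' cls_def C_def)

lemma cls_eq_iff: "p \<in> C \<Longrightarrow> q \<in> C \<Longrightarrow> cls p = cls q \<longleftrightarrow> p - q \<in> I"
  using quotient_eq_iff_same_a_r_cos[OF ideal, of p q]
  by (simp add: cls_def F_minus C_def[symmetric])

lemma cls_mult: "p \<in> C \<Longrightarrow> q \<in> C \<Longrightarrow> cls p \<otimes>\<^bsub>Q\<^esub> cls q = cls (p * q)"
  using rcoset_mult_add[of p q]
  by (simp add: quot_algebra_def ring.defs module.defs FactRing_def cls_def C_def F_simps)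

lemma cls_add: "p \<in> C \<Longrightarrow> q \<in> C \<Longrightarrow> cls p \<oplus>\<^bsub>Q\<^esub> cls q = cls (p + q)"
  using a_rcos_sum[of p q]
  by (simp add: quot_algebra_def ring.defs module.defs FactRing_def cls_def C_def F_simps)

lemma cls_one: "\<one>\<^bsub>Q\<^esub> = cls 1"
  by (simp add: quot_algebra_def ring.defs module.defs FactRing_def cls_def F_simps)

lemma cls_zero: "\<zero>\<^bsub>Q\<^esub> = cls 0"
  using a_rcos_zero[OF ideal, of 0] J_zero
  by (simp add: quot_algebra_def ring.defs module.defs FactRing_def cls_def F_simps)

lemma cls_smult: "p \<in> C \<Longrightarrow> c \<odot>\<^bsub>Q\<^esub> cls p = cls (const c * p)"
  using smult_quot_free_algebra[OF ideal, of p c] by (simp add: cls_def C_def F_simps)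

lemmas cls_simps = cls_mult cls_add cls_one cls_zero cls_smult
lemmas C_closed = C_one C_zero C_add C_mult C_diff C_uminus const_in_C

lemma ring_Q: "ring Q"
proof (intro ringI abelian_groupI monoidI)
  show "\<exists>y\<in>carrier Q. y \<oplus>\<^bsub>Q\<^esub> x = \<zero>\<^bsub>Q\<^esub>" if "x \<in> carrier Q" for x
  proof -
    obtain p where p: "p \<in> C" "x = cls p" using \<open>x \<in> carrier Q\<close> by (auto simp: carrier_Q)
    then show ?thesis by (intro bexI[of _ "cls (- p)"]) (auto simp: carrier_Q cls_simps C_closed)
  qed
qed (auto simp: carrier_Q cls_simps C_closed algebra_simps)

lemma smult_closed_Q: "x \<in> carrier Q \<Longrightarrow> c \<odot>\<^bsub>Q\<^esub> x \<in> carrier Q"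
  by (auto simp: carrier_Q cls_simps C_closed)

text \<open>
  Automorphisms are handled by their lifts to the free algebra. The shears already are inverse to
  each other there, so equations between them need not be proved modulo the relations.
\<close>

definition preserving :: "(('x list \<Rightarrow>\<^sub>0 'k) \<Rightarrow> 'x list \<Rightarrow>\<^sub>0 'k) \<Rightarrow> bool" where
  "preserving f \<longleftrightarrow> alg_hom const f \<and> f ` C \<subseteq> C \<and> f ` I \<subseteq> I"

definition induced :: "(('x list \<Rightarrow>\<^sub>0 'k) \<Rightarrow> 'x list \<Rightarrow>\<^sub>0 'k) \<Rightarrow> ('x list \<Rightarrow>\<^sub>0 'k) set \<Rightarrow> ('x list \<Rightarrow>\<^sub>0 'k) set" where
  "induced f = (\<lambda>K\<in>carrier Q. \<Union>p\<in>K. cls (f p))"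

lemma preserving_id: "preserving id" by (simp add: preserving_def alg_hom_def)

lemma preserving_comp: "preserving f \<Longrightarrow> preserving g \<Longrightarrow> preserving (f \<circ> g)"
  by (simp add: preserving_def alg_hom_def image_subset_iff)

lemma induced_cls:
  assumes f: "preserving f" and p: "p \<in> C"
  shows "induced f (cls p) = cls (f p)"
proof -
  have hom: "alg_hom const f" and C: "f ` C \<subseteq> C" and I: "f ` I \<subseteq> I"
    using f by (auto simp: preserving_def)
  have "cls (f q) = cls (f p)" if "q \<in> cls p" for q
  proof -
    have q: "q \<in> C" using that p a_r_coset_subset_G[OF a_subset] unfolding cls_def C_def by blast
    have "cls q = cls p"
      using a_repr_independence[OF that[unfolded cls_def] _ a_subgroup] p by (simp add: C_def cls_def)
    then have "f (q - p) \<in> I" using I p q by (auto simp: cls_eq_iff)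
    then show ?thesis using C p q by (subst cls_eq_iff) (auto simp: alg_homD[OF hom])
  qed
  moreover have "p \<in> cls p" unfolding cls_def using p by (intro a_rcos_self) (simp add: C_def)
  ultimately have "(\<Union>q\<in>cls p. cls (f q)) = cls (f p)" by blast
  then show ?thesis using p by (simp add: induced_def carrier_Q)
qed

lemma induced_in_carrier: "preserving f \<Longrightarrow> K \<in> carrier Q \<Longrightarrow> induced f K \<in> carrier Q"
  by (auto simp: carrier_Q induced_cls) (auto simp: preserving_def)

lemma induced_comp:
  assumes "preserving f" "preserving g"
  shows "compose (carrier Q) (induced f) (induced g) = induced (f \<circ> g)"
proof (rule extensionalityI)
  fix K assume "K \<in> carrier Q"
  then obtain p where p: "p \<in> C" "K = cls p" by (auto simp: carrier_Q)
  then have "g p \<in> C" using assms by (auto simp: preserving_def)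
  with p \<open>K \<in> carrier Q\<close> assms show "compose (carrier Q) (induced f) (induced g) K = induced (f \<circ> g) K"
    by (simp add: compose_def induced_cls preserving_comp)
qed (auto simp: induced_def)

lemma induced_id: "induced id = (\<lambda>K\<in>carrier Q. K)"
  by (rule extensionalityI[of _ "carrier Q"])
     (auto simp: carrier_Q induced_cls preserving_id, auto simp: induced_def carrier_Q)

lemma induced_auto:
  assumes f: "preserving f" and g: "preserving g" and "f \<circ> g = id" "g \<circ> f = id"
  shows "induced f \<in> algebra_auto Q"
proof -
  have hom: "alg_hom const f" and C: "\<And>p. p \<in> C \<Longrightarrow> f p \<in> C"
    using f by (auto simp: preserving_def)
  have "f 1 = 1" using alg_homD(3)[OF hom, of 1] by (simp add: const_one)
  have "induced f \<in> ring_hom Q Q"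
  proof (rule ring_hom_memI)
    fix K K' assume "K \<in> carrier Q" "K' \<in> carrier Q"
    then obtain p q where "p \<in> C" "q \<in> C" "K = cls p" "K' = cls q" by (auto simp: carrier_Q)
    then show "induced f (K \<otimes>\<^bsub>Q\<^esub> K') = induced f K \<otimes>\<^bsub>Q\<^esub> induced f K'"
      and "induced f (K \<oplus>\<^bsub>Q\<^esub> K') = induced f K \<oplus>\<^bsub>Q\<^esub> induced f K'"
      by (simp_all add: cls_mult cls_add C_mult C_add C induced_cls[OF f] alg_homD(1,2)[OF hom])
  qed (use \<open>f 1 = 1\<close> in \<open>simp_all add: induced_in_carrier f cls_one induced_cls C_one\<close>)
  moreover have "induced f (c \<odot>\<^bsub>Q\<^esub> K) = c \<odot>\<^bsub>Q\<^esub> induced f K" if "K \<in> carrier Q" for c K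
  proof -
    obtain p where "p \<in> C" "K = cls p" using \<open>K \<in> carrier Q\<close> by (auto simp: carrier_Q)
    then show ?thesis
      by (simp add: cls_smult C_mult const_in_C C induced_cls[OF f] alg_homD(2,3)[OF hom])
  qed
  moreover have inv: "induced g (induced f K) = K" "induced f (induced g K) = K" if "K \<in> carrier Q" for K
    using induced_comp[OF g f] induced_comp[OF f g] assms(3,4) that
    by (simp_all add: induced_id compose_def fun_eq_iff restrict_def split: if_splits)
  then have "bij_betw (induced f) (carrier Q) (carrier Q)"
    by (intro bij_betwI[of _ _ _ "induced g"]) (auto intro: induced_in_carrier f g)
  then have "induced f \<in> Bij (carrier Q)" by (simp add: Bij_def induced_def)
  ultimately show ?thesis by (simp add: algebra_auto_def)
qed

lemma group_auto: "group (algebra_AutoGroup Q)"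
  by (rule group_algebra_AutoGroup[OF ring_Q smult_closed_Q])

lemma auto_mult:
  assumes "induced f \<in> algebra_auto Q" "induced g \<in> algebra_auto Q" "preserving f" "preserving g"
  shows "induced f \<otimes>\<^bsub>algebra_AutoGroup Q\<^esub> induced g = induced (f \<circ> g)"
  using assms by (simp add: algebra_AutoGroup_def BijGroup_def algebra_auto_def induced_comp)

lemma auto_one: "\<one>\<^bsub>algebra_AutoGroup Q\<^esub> = induced id"
  by (simp add: algebra_AutoGroup_def BijGroup_def induced_id)

lemma subst_in_C:
  assumes "\<And>i. i \<in> S \<Longrightarrow> y i \<in> C" "p \<in> C"
  shows "subst y p \<in> C"
proof -
  have word: "prod_list (map y w) \<in> C" if "set w \<subseteq> S" for w
    using that by (induction w) (auto intro: C_one C_mult assms(1))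
  have sum: "sum f A \<in> C" if "\<And>x. x \<in> A \<Longrightarrow> f x \<in> C" for f :: "_ \<Rightarrow> _" and A :: "'x list set"
    using that by (induction A rule: infinite_finite_induct) (auto intro: C_zero C_add)
  then show ?thesis
    unfolding free_eval_def using assms(2)
    by (intro sum C_mult const_in_C word) (auto simp: mem_C)
qed

end

text \<open>
  The preimage of an ideal is an ideal. This is used for substitutions, where \<open>J\<close> is the ideal of
  relations itself, and for representations, where \<open>J\<close> is zero.
\<close>

lemma image_Idl_subset:
  fixes h :: "('x list \<Rightarrow>\<^sub>0 'k::field) \<Rightarrow> 'b::ring_1"
  assumes h: "alg_hom e h" and R: "R \<subseteq> carrier (free_algebra S)"
    and J: "two_sided_ideal D J" and D: "h ` carrier (free_algebra S) \<subseteq> D" and RJ: "h ` R \<subseteq> J"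
  shows "h ` (Idl\<^bsub>free_algebra S\<^esub> R) \<subseteq> J"
proof -
  interpret J: two_sided_ideal D J by fact
  interpret ring "free_algebra S :: ('k, 'x list \<Rightarrow>\<^sub>0 'k) module" by (rule ring_free_algebra)
  interpret free_quotient S "carrier (free_algebra S :: ('k, 'x list \<Rightarrow>\<^sub>0 'k) module)"
    by (rule free_quotient.intro) (rule oneideal)
  define K where "K = {p \<in> C. h p \<in> J}"
  have D': "h p \<in> D" if "p \<in> C" for p using D that by (auto simp: C_def)
  have "ideal K F"
  proof (rule idealI[OF ring_axioms])
    show "subgroup K (add_monoid F)"
    proof (rule subgroup.intro)
      show "inv\<^bsub>add_monoid F\<^esub> p \<in> K" if "p \<in> K" for p
        using that by (auto simp: K_def a_inv_def[symmetric] F_uminus C_uminus alg_homD[OF h] J.J_uminus)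
    qed (auto simp: K_def F_simps C_def[symmetric] C_add C_zero alg_homD[OF h] J.J_add J.J_zero)
    show "x \<otimes>\<^bsub>F\<^esub> p \<in> K" "p \<otimes>\<^bsub>F\<^esub> x \<in> K" if "p \<in> K" "x \<in> carrier F" for p x
      using that D' by (auto simp: K_def F_simps C_def[symmetric] C_mult alg_homD[OF h] J.J_left J.J_right)
  qed
  then have "Idl\<^bsub>F\<^esub> R \<subseteq> K"
    by (rule genideal_minimal) (use R RJ in \<open>auto simp: K_def C_def\<close>)
  then show ?thesis by (auto simp: K_def)
qed

section \<open>Automorphisms of \<open>V\<^sub>n\<close>\<close>

locale odd_V =
  fixes n :: nat and a :: "nat \<Rightarrow> nat \<Rightarrow> 'k::field"
  assumes n: "n \<ge> 3" and odd_n: "odd n" and two: "(2 :: 'k) \<noteq> 0"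
begin

declare One_nat_def [simp del]

definition I :: "(nat list \<Rightarrow>\<^sub>0 'k) set" where "I = Idl\<^bsub>free_algebra {1..n}\<^esub> (V_relations n a)"

lemma relations_in_carrier: "V_relations n a \<subseteq> carrier (free_algebra {1..n})"
proof -
  interpret ring "free_algebra {1..n} :: ('k, nat list \<Rightarrow>\<^sub>0 'k) module" by (rule ring_free_algebra)
  interpret q: free_quotient "{1..n}" "carrier (free_algebra {1..n} :: ('k, nat list \<Rightarrow>\<^sub>0 'k) module)"
    by (rule free_quotient.intro) (rule oneideal)
  show ?thesis
    unfolding V_relations_def q.C_def[symmetric]
    by (auto intro!: q.C_diff q.C_add q.C_mult q.gen_in_C q.const_in_C simp del: mult_single)
qed

sublocale free_quotient "{1..n}" I
proof (rule free_quotient.intro)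
  interpret ring "free_algebra {1..n} :: ('k, nat list \<Rightarrow>\<^sub>0 'k) module" by (rule ring_free_algebra)
  show "ideal I (free_algebra {1..n})"
    unfolding I_def by (rule genideal_ideal[OF relations_in_carrier])
qed

lemma relation:
  assumes "1 \<le> i" "i < j" "j \<le> n"
  shows "gen i * gen j + gen j * gen i - const (a i j) \<in> I"
proof -
  interpret ring F by (rule ring_free_algebra)
  have "gen i * gen j + gen j * gen i - const (a i j) \<in> V_relations n a"
    unfolding V_relations_def using assms by blast
  then show ?thesis unfolding I_def using genideal_self[OF relations_in_carrier] by blast
qed

lemma gen_scalar_anticommutator:
  assumes "i \<in> {1..n}" "j \<in> {1..n}" "i \<noteq> j"
  shows "scalar_anticommutator (gen i) (gen j)"
proof (cases "i < j")
  case True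
  with assms show ?thesis
    unfolding scalar_anticommutator_def using relation[of i j] const_central by fastforce
next
  case False
  with assms have "gen i * gen j + gen j * gen i - const (a j i) \<in> I"
    using relation[of j i] by (simp add: add.commute)
  then show ?thesis unfolding scalar_anticommutator_def using const_central by blast
qed

lemma preserving_substI:
  assumes y: "\<And>i. i \<in> {1..n} \<Longrightarrow> y i \<in> C"
    and rel: "\<And>i j. 1 \<le> i \<Longrightarrow> i < j \<Longrightarrow> j \<le> n \<Longrightarrow> y i * y j + y j * y i - const (a i j) \<in> I"
  shows "preserving (subst y)"
  unfolding preserving_def
proof (intro conjI)
  show hom: "alg_hom const (subst y)" by (rule const.alg_hom_free_eval)
  show C: "subst y ` C \<subseteq> C" using subst_in_C[of y, OF y] by blast
  have "subst y ` V_relations n a \<subseteq> I"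
    unfolding V_relations_def
    by (auto simp: alg_homD[OF hom] const.free_eval_gen rel simp del: mult_single)
  then show "subst y ` I \<subseteq> I"
    unfolding I_def[symmetric] using image_Idl_subset[OF hom relations_in_carrier two_sided_ideal_axioms] C
    by (simp add: C_def I_def)
qed

definition tail :: "nat list" where "tail = [3..<Suc n]"

text \<open>
  Up to a power of 2 the wedge product of the generators \<open>x\<^sub>v, x\<^sub>3, \<dots>, x\<^sub>n\<close>; with \<open>v\<close> one of 1 and 2
  there are \<open>n - 1\<close> of them, an even number.
\<close>

definition blade :: "nat \<Rightarrow> nat list \<Rightarrow>\<^sub>0 'k" where
  "blade v = wedge (map gen (v # tail))"

definition coef :: "nat \<Rightarrow> bool \<Rightarrow> nat list \<Rightarrow>\<^sub>0 'k" where
  "coef i b = (if b then 1 else - 1) * (gen 3 * gen 3) ^ i"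

definition shear :: "nat \<Rightarrow> nat \<Rightarrow> (nat list \<Rightarrow>\<^sub>0 'k) \<Rightarrow> (nat list \<Rightarrow>\<^sub>0 'k) \<Rightarrow> nat list \<Rightarrow>\<^sub>0 'k" where
  "shear u v p = subst (gen(u := gen u + p * blade v))"

lemma set_tail: "set tail = {3..n}" by (auto simp: tail_def)
lemma length_tail: "length tail = n - 2" using n by (simp add: tail_def)

lemma sign_tail: "(- 1) ^ length tail = (- 1 :: 'r::ring_1)"
  using n odd_n by (simp add: length_tail)

lemma blade_in_C: "v \<in> {1..n} \<Longrightarrow> blade v \<in> C"
  unfolding blade_def by (intro C_wedge) (auto simp: set_tail gen_in_C)

lemma coef_in_C: "coef i b \<in> C"
  using n unfolding coef_def by (auto intro!: C_mult C_power C_uminus C_one gen_in_C simp del: mult_single)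

lemma blade_anticommute:
  assumes "v \<in> {1, 2}" "j \<in> insert v {3..n}"
  shows "gen j * blade v + blade v * gen j \<in> I"
proof -
  have "sorted_wrt (<) (v # tail)" using assms by (auto simp: tail_def simp del: upt_Suc)
  then have "sorted_wrt (\<lambda>i j. scalar_anticommutator (gen i) (gen j)) (v # tail)"
    by (rule sorted_wrt_mono_rel[rotated])
       (use assms n set_tail in \<open>auto intro!: gen_scalar_anticommutator\<close>)
  then have "sorted_wrt scalar_anticommutator (map gen (v # tail))"
    by (simp add: sorted_wrt_map)
  moreover have "set (map gen (v # tail)) \<subseteq> C" using assms n by (auto simp: set_tail intro!: gen_in_C)
  moreover have "(gen j :: nat list \<Rightarrow>\<^sub>0 'k) \<in> set (map gen (v # tail))" using assms by (auto simp: set_tail)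
  ultimately have "gen j * blade v + (- 1) ^ length (map (gen :: nat \<Rightarrow> nat list \<Rightarrow>\<^sub>0 'k) (v # tail)) * (blade v * gen j) \<in> I"
    unfolding blade_def by (rule anticommute_wedge)
  then show ?thesis by (simp add: sign_tail)
qed

lemma coef_commute:
  assumes "j \<in> {1..n}"
  shows "gen j * coef i b - coef i b * gen j \<in> I"
proof -
  have three: "gen 3 \<in> C" using n by (intro gen_in_C) auto
  have "gen 3 * gen 3 * gen j - gen j * (gen 3 * gen 3) \<in> I"
  proof (cases "j = 3")
    case False
    then show ?thesis using assms n three by (intro square_commutes gen_scalar_anticommutator) auto
  qed (simp add: J_zero mult.assoc del: mult_single)
  from J_uminus[OF this] have square: "gen j * (gen 3 * gen 3) - gen 3 * gen 3 * gen j \<in> I"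
    by (simp del: mult_single)
  have "gen j * (gen 3 * gen 3) ^ i - (gen 3 * gen 3) ^ i * gen j \<in> I"
    by (induction i) (auto intro!: commute_mult square C_mult C_power three simp: J_zero simp del: mult_single)
  then show ?thesis
    unfolding coef_def
    by (intro commute_mult) (auto intro!: C_mult C_power C_uminus C_one three simp: J_zero simp del: mult_single)
qed

lemma shear_alg_hom: "alg_hom const (shear u v p)"
  unfolding shear_def by (rule const.alg_hom_free_eval)

lemma shear_gen: "shear u v p (gen i) = (if i = u then gen u + p * blade v else gen i)"
  unfolding shear_def by (simp add: const.free_eval_gen)

lemma alg_hom_wedge:
  assumes "alg_hom const h"
  shows "h (wedge xs) = wedge (map h xs)"
  by (rule wedge_map_hom) (simp_all add: alg_homD(1-2)[OF assms] alg_homD(3)[OF assms, of 1, unfolded const_one])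

lemma alg_hom_coef:
  assumes h: "alg_hom const h" and "h (gen 3) = gen 3"
  shows "h (coef i b) = coef i b"
proof -
  have one: "h 1 = 1" using alg_homD(3)[OF h, of 1] by (simp add: const_one)
  have "h ((gen 3 * gen 3) ^ i) = (gen 3 * gen 3) ^ i"
    by (induction i) (simp_all add: one alg_homD(2)[OF h] assms del: mult_single)
  then show ?thesis by (simp add: coef_def alg_homD[OF h] one)
qed

text \<open>
  The recursion for wedge products adds \<open>x\<^sub>v\<close> to a product of odd length, which makes the blade a
  commutator and in particular linear in \<open>x\<^sub>v\<close>.
\<close>

lemma alg_hom_blade:
  assumes h: "alg_hom const h" and "\<And>i. i \<ge> 3 \<Longrightarrow> h (gen i) = gen i"
  shows "h (blade v) = wedge (map gen tail) * h (gen v) - h (gen v) * wedge (map gen tail)"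
proof -
  have "map (h \<circ> gen) tail = map gen tail" using assms(2) by (auto simp: set_tail)
  then show ?thesis
    by (simp add: blade_def sign_tail alg_homD[OF h] alg_hom_wedge[OF h] del: map_eq_conv)
qed

lemma blade_eq: "blade v = wedge (map gen tail) * gen v - gen v * wedge (map gen tail)"
  using alg_hom_blade[of id v] by (simp add: alg_hom_def)

text \<open>
  Only the relations that involve \<open>x\<^sub>u\<close> change, and they change by the anticommutator of a generator
  with \<open>f = p [w, x\<^sub>v]\<close>. It vanishes because \<open>p\<close> is central and the blade anticommutes with its
  vectors, which are all generators except \<open>x\<^sub>u\<close>.
\<close>

lemma preserving_shear:
  assumes "(u, v) \<in> {(1, 2), (2, 1)}"
  shows "preserving (shear u v (coef i b))"
proof -
  define f where "f = coef i b * blade v"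
  have f: "f \<in> C" using assms n unfolding f_def by (auto intro!: C_mult coef_in_C blade_in_C)
  have u: "gen u \<in> C" using assms n by (intro gen_in_C) auto
  have anti: "gen j * f + f * gen j \<in> I" if "j \<in> {1..n} - {u}" for j
  proof -
    have "j \<in> insert v {3..n}" using that assms by auto
    then have 1: "gen j * blade v + blade v * gen j \<in> I" using assms by (intro blade_anticommute) auto
    have 2: "gen j * coef i b - coef i b * gen j \<in> I" using that by (intro coef_commute) auto
    have "gen j * f + f * gen j =
        (gen j * coef i b - coef i b * gen j) * blade v + coef i b * (gen j * blade v + blade v * gen j)"
      unfolding f_def by (simp add: algebra_simps)
    also have "\<dots> \<in> I"
      using assms n by (intro J_add J_right[OF 2] J_left[OF _ 1] coef_in_C blade_in_C) auto
    finally show ?thesis .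
  qed
  show ?thesis
    unfolding shear_def f_def[symmetric]
  proof (rule preserving_substI)
    fix j k assume jk: "1 \<le> j" "j < k" "k \<le> n"
    note r = relation[OF jk]
    have "(gen j * gen k + gen k * gen j - const (a j k)) + (gen k * f + f * gen k) \<in> I" if "j = u"
      using jk that by (intro J_add r anti) auto
    moreover have "(gen j * gen k + gen k * gen j - const (a j k)) + (gen j * f + f * gen j) \<in> I" if "k = u"
      using jk that by (intro J_add r anti) auto
    ultimately show "(gen(u := gen u + f)) j * (gen(u := gen u + f)) k +
        (gen(u := gen u + f)) k * (gen(u := gen u + f)) j - const (a j k) \<in> I"
      using jk r by (auto simp: algebra_simps simp del: mult_single)
  qed (simp add: C_add gen_in_C f u del: atLeastAtMost_iff)
qed

lemma shear_inverse:
  assumes "(u, v) \<in> {(1, 2), (2, 1)}"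
  shows "shear u v (coef i b) \<circ> shear u v (coef i (\<not> b)) = id"
proof (rule alg_hom_eqI)
  let ?h = "shear u v (coef i b)"
  note hom = shear_alg_hom[of u v "coef i b"]
  show "alg_hom const (?h \<circ> shear u v (coef i (\<not> b)))" by (intro alg_hom_comp shear_alg_hom)
  show "alg_hom const id" by (simp add: alg_hom_def)
  have "?h (gen 3) = gen 3" using assms by (auto simp: shear_gen)
  then have "?h (coef i (\<not> b)) = coef i (\<not> b)" by (rule alg_hom_coef[OF hom])
  moreover have "?h (blade v) = blade v"
    using assms by (subst alg_hom_blade[OF hom]) (auto simp: shear_gen blade_eq)
  moreover have "coef i (\<not> b) = - coef i b" by (auto simp: coef_def)
  ultimately show "(?h \<circ> shear u v (coef i (\<not> b))) (gen j) = id (gen j)" for j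
    by (simp add: shear_gen alg_homD[OF hom])
qed

text \<open>
  The letter \<open>(i, True)\<close> is \<open>g\<^sub>i = \<phi>\<^sub>p \<psi>\<^sub>p\<close> and \<open>(i, False)\<close> is its inverse \<open>\<psi>\<^sub>-\<^sub>p \<phi>\<^sub>-\<^sub>p\<close>. Two shears
  per letter are needed because the shears of one kind commute.
\<close>

definition letter :: "nat \<times> bool \<Rightarrow> (nat list \<Rightarrow>\<^sub>0 'k) \<Rightarrow> nat list \<Rightarrow>\<^sub>0 'k" where
  "letter x = (case x of (i, b) \<Rightarrow>
     if b then shear 1 2 (coef i b) \<circ> shear 2 1 (coef i b)
     else shear 2 1 (coef i b) \<circ> shear 1 2 (coef i b))"

definition word_map :: "(nat \<times> bool) list \<Rightarrow> (nat list \<Rightarrow>\<^sub>0 'k) \<Rightarrow> nat list \<Rightarrow>\<^sub>0 'k" where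
  "word_map w = foldr (\<lambda>x f. letter x \<circ> f) w id"

lemma preserving_letter: "preserving (letter x)"
  by (auto simp: letter_def split: prod.split intro!: preserving_comp preserving_shear)

lemma letter_inverse: "letter (i, b) \<circ> letter (i, \<not> b) = id"
proof -
  have *: "(f \<circ> g) \<circ> (g' \<circ> f') = id" if "f \<circ> f' = id" "g \<circ> g' = id"
    for f g f' g' :: "(nat list \<Rightarrow>\<^sub>0 'k) \<Rightarrow> nat list \<Rightarrow>\<^sub>0 'k"
    using that by (metis comp_assoc comp_id)
  show ?thesis
    using *[OF shear_inverse[of 1 2 i b] shear_inverse[of 2 1 i b]]
      *[OF shear_inverse[of 2 1 i b] shear_inverse[of 1 2 i b]]
    by (cases b) (simp_all add: letter_def)
qed

lemma word_map_Nil [simp]: "word_map [] = id"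
  and word_map_Cons [simp]: "word_map (x # w) = letter x \<circ> word_map w"
  by (simp_all add: word_map_def)

lemma word_map_snoc: "word_map (w @ [x]) = word_map w \<circ> letter x"
  by (induction w) (simp_all add: comp_assoc)

lemma preserving_word_map: "preserving (word_map w)"
  by (induction w) (simp_all only: word_map_Nil word_map_Cons preserving_id preserving_comp preserving_letter)

lemma induced_letter: "induced (letter x) \<in> algebra_auto Q"
proof (cases x)
  case (Pair i b)
  show ?thesis
    unfolding Pair using letter_inverse[of i b] letter_inverse[of i "\<not> b"]
    by (intro induced_auto[of _ "letter (i, \<not> b)"] preserving_letter) simp_all
qed

abbreviation Aut :: "((nat list \<Rightarrow>\<^sub>0 'k) set \<Rightarrow> (nat list \<Rightarrow>\<^sub>0 'k) set) monoid" where
  "Aut \<equiv> algebra_AutoGroup Q"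

lemma carrier_Aut: "carrier Aut = algebra_auto Q"
  by (simp add: algebra_AutoGroup_def)

lemma letter_value_letter: "letter_value Aut (\<lambda>i. induced (letter (i, True))) x = induced (letter x)"
proof -
  interpret group Aut by (rule group_auto)
  have "inv\<^bsub>Aut\<^esub> induced (letter (i, True)) = induced (letter (i, False))" for i
    using letter_inverse[of i False] induced_letter preserving_letter
    by (intro inv_equality) (simp_all add: auto_mult auto_one carrier_Aut)
  then show ?thesis by (cases x) (auto simp: letter_value_def)
qed

lemma word_value_letter:
  "word_value Aut (\<lambda>i. induced (letter (i, True))) w = induced (word_map w) \<and> induced (word_map w) \<in> algebra_auto Q"
proof (induction w)
  case Nil
  interpret group Aut by (rule group_auto)
  show ?case using one_closed by (simp only: word_value_Nil word_map_Nil auto_one carrier_Aut simp_thms)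
next
  case (Cons x w)
  interpret group Aut by (rule group_auto)
  have "induced (letter x) \<otimes>\<^bsub>Aut\<^esub> induced (word_map w) \<in> carrier Aut"
    using Cons induced_letter by (intro m_closed) (auto simp: carrier_Aut)
  moreover have "induced (letter x) \<otimes>\<^bsub>Aut\<^esub> induced (word_map w) = induced (word_map (x # w))"
    unfolding word_map_Cons using Cons
    by (intro auto_mult induced_letter preserving_letter preserving_word_map) simp
  ultimately show ?case
    using Cons by (simp only: word_value_Cons letter_value_letter carrier_Aut simp_thms)
qed

section \<open>A representation by Laurent series of operators\<close>

text \<open>
  The conditions \<open>j < l\<close> put each scalar \<open>a\<^sub>i\<^sub>j\<close> into exactly one of the two operators \<open>N\<^sub>i\<close> and
  \<open>N\<^sub>j\<close>; it is then the anticommutator of \<open>E\<^sub>j\<close> with \<open>N\<^sub>i\<close>.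
\<close>

definition lower :: "nat \<Rightarrow> 'k operator" where
  "lower j = (\<Sum>l=1..n. scalar (if j < l then a j l else 0) * annihilation l)"

text \<open>
  The series \<open>t\<^sup>-\<^sup>1 E\<^sub>j + t N\<^sub>j\<close>. The exponents are opposite so that the mixed terms of an
  anticommutator are constant.
\<close>

definition rep_gen :: "nat \<Rightarrow> 'k operator fls" where
  "rep_gen j = fls_shift 1 (fls_const (clifford j)) + fls_shift (- 1) (fls_const (lower j))"

definition fls_scalar :: "'k \<Rightarrow> 'k operator fls" where "fls_scalar c = fls_const (scalar c)"

sublocale fls_scalar: scalar_embedding fls_scalar
proof
  show "fls_scalar c * b = b * fls_scalar c" for c b
    by (rule fls_eqI) (simp add: fls_scalar_def scalar_central)
  show "fls_scalar (c + d) = fls_scalar c + fls_scalar d" for c d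
    by (rule fls_eqI) (simp add: fls_scalar_def scalar_add)
qed (simp_all add: fls_scalar_def scalar_mult scalar_one)

definition rho :: "(nat list \<Rightarrow>\<^sub>0 'k) \<Rightarrow> 'k operator fls" where "rho = free_eval fls_scalar rep_gen"

lemma rho_hom: "alg_hom fls_scalar rho" unfolding rho_def by (rule fls_scalar.alg_hom_free_eval)

lemma rho_gen: "rho (gen i) = rep_gen i" unfolding rho_def by (rule fls_scalar.free_eval_gen)

lemma leading_rep_gen: "leading 1 (rep_gen j) (clifford j)"
  by (simp add: leading_def rep_gen_def)

lemma clifford_lower:
  assumes "i \<in> {1..n}"
  shows "clifford i * lower j + lower j * clifford i = scalar (if j < i then a j i else 0)"
proof -
  define c where "c l = (if j < l then a j l else 0)" for l
  have "clifford i * (scalar (c l) * annihilation l) = scalar (c l) * (clifford i * annihilation l)" for l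
    by (metis mult.assoc scalar_central)
  then have "clifford i * lower j + lower j * clifford i =
      (\<Sum>l=1..n. scalar (c l) * (clifford i * annihilation l + annihilation l * clifford i))"
    by (simp add: lower_def sum_distrib_left sum_distrib_right sum.distrib distrib_left mult.assoc flip: c_def)
  also have "\<dots> = (\<Sum>l=1..n. if i = l then scalar (c l) else 0)"
    by (intro sum.cong) (auto simp: clifford_annihilation)
  also have "\<dots> = scalar (c i)" using assms by simp
  finally show ?thesis by (simp add: c_def)
qed

lemma lower_anticommute: "lower i * lower j + lower j * lower i = 0"
proof -
  define c where "c j l = (if j < l then a j l else 0)" for j l
  have swap: "(scalar (c i l) * annihilation l) * (scalar (c j k) * annihilation k) =
      scalar (c i l * c j k) * (annihilation l * annihilation k)" for i j k l
    unfolding scalar_mult by (metis mult.assoc scalar_central)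
  have product: "lower i * lower j =
      (\<Sum>l=1..n. \<Sum>k=1..n. scalar (c i l * c j k) * (annihilation l * annihilation k))" for i j
    by (simp add: lower_def sum_product swap flip: c_def)
  have "lower j * lower i =
      (\<Sum>l=1..n. \<Sum>k=1..n. scalar (c i l * c j k) * (annihilation k * annihilation l))"
    unfolding product by (subst sum.swap) (simp add: mult.commute)
  then have "lower i * lower j + lower j * lower i =
      (\<Sum>l=1..n. \<Sum>k=1..n. scalar (c i l * c j k) *
        (annihilation l * annihilation k + annihilation k * annihilation l))"
    unfolding product[of i j] by (simp add: sum.distrib distrib_left)
  then show ?thesis by (simp add: annihilation_anticommute)
qed

text \<open>
  In the anticommutator the coefficient of \<open>t\<^sup>-\<^sup>2\<close> vanishes because the \<open>E\<^sub>j\<close> anticommute and that of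
  \<open>t\<^sup>2\<close> because the annihilation operators do.
\<close>

lemma rep_gen_relation:
  assumes "1 \<le> i" "i < j" "j \<le> n"
  shows "rep_gen i * rep_gen j + rep_gen j * rep_gen i = fls_scalar (a i j)"
proof -
  have "clifford i * clifford j + clifford j * clifford i = (0 :: 'k operator)"
    using assms by (subst clifford_anticommute) auto
  moreover have "clifford j * lower i + lower i * clifford j = scalar (a i j)"
    using clifford_lower[of j i] assms by simp
  moreover have "clifford i * lower j + lower j * clifford i = 0"
    using clifford_lower[of i j] assms by (simp add: scalar_zero)
  moreover have "lower i * lower j + lower j * lower i = 0" by (rule lower_anticommute)
  moreover have "rep_gen i * rep_gen j + rep_gen j * rep_gen i =
      fls_shift 2 (fls_const (clifford i * clifford j + clifford j * clifford i)) +
      fls_const ((clifford j * lower i + lower i * clifford j) + (clifford i * lower j + lower j * clifford i)) +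
      fls_shift (- 2) (fls_const (lower i * lower j + lower j * lower i))"
    by (rule fls_eqI) (simp add: rep_gen_def distrib_left distrib_right fls_shifted_times_simps algebra_simps)
  ultimately show ?thesis by (simp add: fls_scalar_def)
qed

lemma rho_I: "p \<in> I \<Longrightarrow> rho p = 0"
proof -
  have "two_sided_ideal (UNIV :: 'k operator fls set) {0}" by standard auto
  moreover have "rho ` V_relations n a \<subseteq> {0}"
    unfolding V_relations_def
    by (auto simp: alg_homD[OF rho_hom] rho_gen rep_gen_relation simp del: mult_single)
  ultimately have "rho ` I \<subseteq> {0}"
    unfolding I_def by (intro image_Idl_subset[OF rho_hom relations_in_carrier]) auto
  then show "p \<in> I \<Longrightarrow> rho p = 0" by auto
qed

section \<open>Growth along reduced words\<close>

definition W :: "'k operator fls" where "W = wedge (map rep_gen tail)"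
definition \<omega> :: "'k operator" where "\<omega> = wedge (map clifford tail)"

sublocale growth W \<omega> "int (n - 2)"
proof
  show "leading (int (n - 2)) W \<omega>"
    unfolding W_def \<omega>_def length_tail[symmetric] by (rule leading_wedge[OF leading_rep_gen])
  show "b = 0" if "\<omega> * b = 0" for b
    using wedge_clifford_cancel[OF two _ that[unfolded \<omega>_def]] by (simp add: tail_def)
  show "b = 0" if "b + b = 0" for b :: "'k operator"
    by (rule operator_double_eq_0[OF two that])
qed (use n in simp)

lemma exact_rep_gen: "v \<in> {1, 2} \<Longrightarrow> exact 1 (rep_gen v)"
proof -
  assume "v \<in> {1, 2}"
  then have "clifford v * \<omega> = - (\<omega> * clifford v)"
    unfolding \<omega>_def using sign_tail[where 'r = "'k operator"]
    by (subst wedge_anticommute_outside) (auto simp: set_tail intro!: clifford_anticommute)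
  moreover have "clifford v \<noteq> (0 :: 'k operator)"
    using clifford_square[of v, where 'k = 'k] by auto
  ultimately show ?thesis unfolding exact_def using leading_rep_gen by (intro exI[of _ "clifford v"]) auto
qed

lemma rho_wedge: "rho (wedge xs) = wedge (map rho xs)"
  by (rule wedge_map_hom)
     (simp_all add: alg_homD(1-2)[OF rho_hom] alg_homD(3)[OF rho_hom, of 1, unfolded const_one] fls_scalar.e_one)

lemma rho_coef: "rho (coef i b) = (if b then 1 else - 1) * (rep_gen 3 * rep_gen 3) ^ i"
proof -
  have one: "rho 1 = 1" using alg_homD(3)[OF rho_hom, of 1] by (simp add: const_one fls_scalar.e_one)
  have "rho ((gen 3 * gen 3) ^ i) = (rep_gen 3 * rep_gen 3) ^ i"
    by (induction i) (simp_all add: one alg_homD(2)[OF rho_hom] rho_gen del: mult_single)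
  then show ?thesis by (simp add: coef_def alg_homD[OF rho_hom] one)
qed

lemma leading_rep_gen_square: "leading 2 (rep_gen 3 * rep_gen 3) 1"
  using leading_mult[OF leading_rep_gen leading_rep_gen, of 3 3] by (simp add: clifford_square)

lemma unit_leading_coef: "unit_leading (rho (coef i b))"
  using unit_leading_power[OF leading_rep_gen_square, of i] unit_leading_uminus by (auto simp: rho_coef)

text \<open>
  Letters with different signs have coefficients \<open>p\<^sub>i\<close> and \<open>- p\<^sub>j\<close>, and distinct powers of an element
  of positive degree cannot cancel.
\<close>

lemma unit_leading_coef_add:
  assumes "i \<noteq> j" "b \<noteq> b'"
  shows "unit_leading (rho (coef i b) + rho (coef j b'))"
  using unit_leading_power_diff[OF leading_rep_gen_square, of i j] unit_leading_power_diff[OF leading_rep_gen_square, of j i] assms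
  by (cases b; cases b') (auto simp: rho_coef)

definition fixing :: "((nat list \<Rightarrow>\<^sub>0 'k) \<Rightarrow> nat list \<Rightarrow>\<^sub>0 'k) \<Rightarrow> bool" where
  "fixing h \<longleftrightarrow> alg_hom const h \<and> (\<forall>i\<ge>3. h (gen i) = gen i)"

definition val :: "((nat list \<Rightarrow>\<^sub>0 'k) \<Rightarrow> nat list \<Rightarrow>\<^sub>0 'k) \<Rightarrow> nat \<Rightarrow> 'k operator fls" where
  "val h v = rho (h (gen v))"

text \<open>
  Appending a shear on the right of a word \<open>h\<close> applies the elementary operation to the pair of images
  of \<open>x\<^sub>1\<close> and \<open>x\<^sub>2\<close>: the coefficient and \<open>w\<close> are fixed by \<open>h\<close>, so \<open>h\<close> acts only on the coordinate
  inside the commutator.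
\<close>

lemma val_shear:
  assumes h: "fixing h" and uv: "(u, v) \<in> {(1, 2), (2, 1)}"
  shows "fixing (h \<circ> shear u v (coef i b))"
    and "val (h \<circ> shear u v (coef i b)) u = val h u + rho (coef i b) * L (val h v)"
    and "val (h \<circ> shear u v (coef i b)) v = val h v"
proof -
  have hom: "alg_hom const h" and fix3: "\<And>i. i \<ge> 3 \<Longrightarrow> h (gen i) = gen i"
    using h by (auto simp: fixing_def)
  show "fixing (h \<circ> shear u v (coef i b))"
    unfolding fixing_def using uv by (auto intro!: alg_hom_comp hom shear_alg_hom simp: shear_gen fix3)
  have "h (blade v) = wedge (map gen tail) * h (gen v) - h (gen v) * wedge (map gen tail)"
    using hom fix3 by (rule alg_hom_blade)
  then have "rho (h (blade v)) = L (val h v)"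
    unfolding L_def val_def
    unfolding W_def
    by (simp add: alg_homD[OF rho_hom] rho_wedge rho_gen comp_def)
  then show "val (h \<circ> shear u v (coef i b)) u = val h u + rho (coef i b) * L (val h v)"
    by (simp add: val_def shear_gen alg_homD[OF hom] alg_homD[OF rho_hom] alg_hom_coef[OF hom fix3])
  show "val (h \<circ> shear u v (coef i b)) v = val h v"
    using uv by (auto simp: val_def shear_gen)
qed

text \<open>
  The index of the generator that the first shear of a letter moves; with it the two kinds of letters
  obey the same formulas.
\<close>

definition sheared :: "bool \<Rightarrow> nat" where "sheared b = (if b then 1 else 2)"

lemma val_letter:
  fixes i :: nat and b :: bool
  assumes h: "fixing h"
  defines "h' \<equiv> h \<circ> letter (i, b)" and "q \<equiv> rho (coef i b)"
  shows "fixing h'"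
    and "val h' (sheared b) = val h (sheared b) + q * L (val h (sheared (\<not> b)))"
    and "val h' (sheared (\<not> b)) = val h (sheared (\<not> b)) + q * L (val h' (sheared b))"
proof -
  define h1 where "h1 = h \<circ> shear (sheared b) (sheared (\<not> b)) (coef i b)"
  have uv: "(sheared b, sheared (\<not> b)) \<in> {(1, 2), (2, 1)}" "(sheared (\<not> b), sheared b) \<in> {(1, 2), (2, 1)}"
    by (auto simp: sheared_def)
  have h': "h' = h1 \<circ> shear (sheared (\<not> b)) (sheared b) (coef i b)"
    by (auto simp: h'_def h1_def letter_def sheared_def comp_assoc)
  note 1 = val_shear[OF h uv(1), where i = i and b = b, folded h1_def q_def]
  note 2 = val_shear[OF 1(1) uv(2), where i = i and b = b, folded h' q_def]
  show "fixing h'" by (rule 2(1))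
  show "val h' (sheared b) = val h (sheared b) + q * L (val h (sheared (\<not> b)))"
    using 1 2 by simp
  show "val h' (sheared (\<not> b)) = val h (sheared (\<not> b)) + q * L (val h' (sheared b))"
    using 1 2 by simp
qed

lemma fixing_id: "fixing id" by (simp add: fixing_def alg_hom_def)

lemma fixing_word_map: "fixing (word_map w)"
proof (induction w rule: rev_induct)
  case (snoc x w)
  then show ?case unfolding word_map_snoc by (cases x) (simp only: val_letter(1))
qed (simp only: word_map_Nil fixing_id)

text \<open>
  The induction is on the word extended at its right end, where the elementary operations act. In a
  reduced word a change of sign between neighbours comes with a change of index, which is exactly the
  condition under which the merged coefficient is nonzero.
\<close>

lemma word_map_state:
  assumes "reduced w" "w \<noteq> []" "last w = (i, b)"
  shows "state (val (word_map w) (sheared b)) (val (word_map w) (sheared (\<not> b))) (rho (coef i b))"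
  using assms
proof (induction w arbitrary: i b rule: rev_induct)
  case (snoc x w)
  then have x: "x = (i, b)" by simp
  let ?h = "word_map w" and ?h' = "word_map (w @ [x])"
  note step = val_letter(2,3)[OF fixing_word_map, of w i b, folded x word_map_snoc]
  show ?case
  proof (cases "w = []")
    case True
    have "val id v = rep_gen v" for v by (simp add: val_def rho_gen)
    then have "exact 1 (val ?h (sheared c))" for c using True exact_rep_gen by (simp add: sheared_def)
    then show ?thesis using state_start[OF _ _ unit_leading_coef step] by blast
  next
    case False
    obtain j c where last: "last w = (j, c)" by (cases "last w")
    have red: "reduced w" and nc: "\<not> cancelling (j, c) (i, b)"
      using snoc.prems False last x by (auto simp: reduced_def successively_append_iff)
    note IH = snoc.IH[OF red False last]
    show ?thesis
    proof (cases "c = b")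
      case True
      then show ?thesis
        using state_same_side[OF IH unit_leading_coef unit_leading_coef] step by simp
    next
      case False
      then have "unit_leading (rho (coef j c) + rho (coef i b))"
        using nc by (intro unit_leading_coef_add) (auto simp: cancelling_def)
      moreover have "sheared c = sheared (\<not> b)" "sheared (\<not> c) = sheared b" using False by auto
      ultimately show ?thesis
        using state_other_side[OF IH _ unit_leading_coef] step by simp
    qed
  qed
qed simp

text \<open>
  An automorphism that is trivial on the quotient fixes the image of the generator, whose degree is 1,
  whereas the invariant gives a larger degree.
\<close>

lemma word_value_neq_one:
  assumes "reduced w" "w \<noteq> []"
  shows "word_value Aut (\<lambda>i. induced (letter (i, True))) w \<noteq> \<one>\<^bsub>Aut\<^esub>"
proof
  assume "word_value Aut (\<lambda>i. induced (letter (i, True))) w = \<one>\<^bsub>Aut\<^esub>"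
  then have "induced (word_map w) = induced id" by (simp add: word_value_letter auto_one)
  obtain i b where last: "last w = (i, b)" by (cases "last w")
  define u where "u = sheared b"
  have u: "gen u \<in> C" using n by (intro gen_in_C) (auto simp: u_def sheared_def)
  have image: "word_map w (gen u) \<in> C" using u preserving_word_map[of w] by (auto simp: preserving_def)
  have "cls (word_map w (gen u)) = cls (gen u)"
    using \<open>induced (word_map w) = induced id\<close> induced_cls[OF preserving_word_map u, of w]
      induced_cls[OF preserving_id u] by simp
  then have "word_map w (gen u) - gen u \<in> I" using image u by (simp add: cls_eq_iff)
  then have "val (word_map w) u = rep_gen u"
    using rho_I by (fastforce simp: alg_homD[OF rho_hom] val_def rho_gen)
  then show False
    using word_map_state[OF assms last] leading_rep_gen[of u] state_neq by (metis u_def)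
qed

lemma contains_free_group_Aut: "contains_free_group (algebra_AutoGroup (V_algebra n a)) (S :: nat set)"
proof -
  have "V_algebra n a = Q" by (simp add: V_algebra_def I_def)
  moreover have "contains_free_group Aut S"
    by (rule contains_free_groupI[OF group_auto, where g = "\<lambda>i. induced (letter (i, True))"])
       (simp_all add: carrier_Aut induced_letter word_value_neq_one)
  ultimately show ?thesis by simp
qed

end

theorem theorem2:
  fixes n :: nat and a :: "nat \<Rightarrow> nat \<Rightarrow> 'k::field"
  assumes "n \<ge> 3" and "odd n" and "\<not> CHAR('k) dvd fact (n - 1)"
  shows "contains_free_group (algebra_AutoGroup (V_algebra n a)) {0, 1 :: nat} \<and>
         contains_free_group (algebra_AutoGroup (V_algebra n a)) (UNIV :: nat set)"
proof -
  have "(2 :: 'k) \<noteq> 0"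
  proof
    assume "(2 :: 'k) = 0"
    then have "of_nat 2 = (0 :: 'k)" by simp
    then have "CHAR('k) dvd 2" by (simp only: of_nat_eq_0_iff_char_dvd)
    also have "2 dvd (fact (n - 1) :: nat)" using assms(1) by (intro dvd_fact) auto
    finally show False using assms(3) by simp
  qed
  then interpret odd_V n a using assms by unfold_locales
  show ?thesis by (simp add: contains_free_group_Aut)
qed

end
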